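(* Let $n\ge1$ and let $\mathcal{S}$ be an infinite $E^1_n$-computable family. Then the Rogers semilattice $\mathcal{R}^1_n(\mathcal{S})$ is not weakly distributive.
   Context: Work in ZF+DC. $E^1_n$ denotes $\Pi^1_n$ if $n$ is odd and $\Sigma^1_n$ if $n$ is even (lightface). A numbering of a countable $\mathcal{S}\subset P(\omega)$ is a surjection $\nu:\omega\to\mathcal{S}$; it is $E^1_n$-computable if $\{\langle k,x\rangle: x\in\nu(k)\}\in E^1_n$, and $\mathcal{S}$ is $E^1_n$-computable if it has such a numbering. $\nu\le\mu$ iff $\nu=\mu\circ f$ for some total computable $f$; $\nu\equiv\mu$ iff $\nu\le\mu\le\nu$. $\mathcal{R}^1_n(\mathcal{S})$ is the set of $\equiv$-classes of $E^1_n$-computable numberings of $\mathcal{S}$, ordered by $\le$, with join induced by $(\nu\oplus\mu)(2x)=\nu(x)$, $(\nu\oplus\mu)(2x+1)=\mu(x)$. An upper semilattice $(A;\le,\vee)$ is weakly distributive if for all $b,a_0,a_1\in A$: whenever $b\le a_0\vee a_1$, $b\not\le a_0$ and $b\not\le a_1$, there exist $b_0,b_1\in A$ with $b=b_0\vee b_1$, $b_0\le a_0$, $b_1\le a_1$ (equivalently, adjoining a new least element yields a distributive upper semilattice). *)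

theory Defs
  imports Main "HOL-Library.Nat_Bijection"
begin

section \<open>Computable functions\<close>

text \<open>
  Partial recursive functions in unary form: several arguments are coded by the Cantor pairing
  function \<^const>\<open>prod_encode\<close>, whose projections and tupling are among the initial functions
  and closure conditions.
\<close>

primrec prim_rec :: "(nat \<rightharpoonup> nat) \<Rightarrow> (nat \<rightharpoonup> nat) \<Rightarrow> nat \<Rightarrow> nat \<Rightarrow> nat option" where
  "prim_rec f g a 0 = f a"
| "prim_rec f g a (Suc m) =
     (case prim_rec f g a m of None \<Rightarrow> None | Some i \<Rightarrow> g (prod_encode (a, prod_encode (m, i))))"

text \<open>Unbounded search; it diverges if some value before the first zero is undefined.\<close>

definition mu_search :: "(nat \<rightharpoonup> nat) \<Rightarrow> nat \<rightharpoonup> nat" where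
  "mu_search f a =
     (if \<exists>m. f (prod_encode (a, m)) = Some 0 \<and> (\<forall>j<m. f (prod_encode (a, j)) \<noteq> None)
      then Some (LEAST m. f (prod_encode (a, m)) = Some 0) else None)"

inductive partial_recursive :: "(nat \<rightharpoonup> nat) \<Rightarrow> bool" where
  zero: "partial_recursive (\<lambda>_. Some 0)"
| succ: "partial_recursive (\<lambda>x. Some (Suc x))"
| left: "partial_recursive (\<lambda>x. Some (fst (prod_decode x)))"
| right: "partial_recursive (\<lambda>x. Some (snd (prod_decode x)))"
| pair: "partial_recursive f \<Longrightarrow> partial_recursive g \<Longrightarrow>
    partial_recursive (\<lambda>x. case f x of None \<Rightarrow> None
      | Some u \<Rightarrow> (case g x of None \<Rightarrow> None | Some v \<Rightarrow> Some (prod_encode (u, v))))"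
| comp: "partial_recursive f \<Longrightarrow> partial_recursive g \<Longrightarrow> partial_recursive (f \<circ>\<^sub>m g)"
| prec: "partial_recursive f \<Longrightarrow> partial_recursive g \<Longrightarrow>
    partial_recursive (\<lambda>x. prim_rec f g (fst (prod_decode x)) (snd (prod_decode x)))"
| search: "partial_recursive f \<Longrightarrow> partial_recursive (mu_search f)"

definition computable :: "(nat \<Rightarrow> nat) \<Rightarrow> bool" where
  "computable f \<longleftrightarrow> partial_recursive (\<lambda>x. Some (f x))"


section \<open>The lightface analytical hierarchy\<close>

text \<open>
  Second-order arithmetic with number variables and variables for functions from numbers to
  numbers; \<open>App i t\<close> is the \<open>i\<close>-th function variable applied to \<open>t\<close>.
\<close>

datatype trm =
    NVar nat
  | Zero
  | Succ trm
  | Plus trm trm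
  | Times trm trm
  | App nat trm

datatype fml =
    Equal trm trm
  | Less trm trm
  | Neg fml
  | And fml fml
  | Or fml fml
  | AllN nat fml
  | ExN nat fml
  | AllF nat fml
  | ExF nat fml

primrec trm_val :: "(nat \<Rightarrow> nat) \<Rightarrow> (nat \<Rightarrow> nat \<Rightarrow> nat) \<Rightarrow> trm \<Rightarrow> nat" where
  "trm_val e F (NVar i) = e i"
| "trm_val e F Zero = 0"
| "trm_val e F (Succ t) = Suc (trm_val e F t)"
| "trm_val e F (Plus s t) = trm_val e F s + trm_val e F t"
| "trm_val e F (Times s t) = trm_val e F s * trm_val e F t"
| "trm_val e F (App i t) = F i (trm_val e F t)"

primrec sat :: "(nat \<Rightarrow> nat) \<Rightarrow> (nat \<Rightarrow> nat \<Rightarrow> nat) \<Rightarrow> fml \<Rightarrow> bool" where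
  "sat e F (Equal s t) \<longleftrightarrow> trm_val e F s = trm_val e F t"
| "sat e F (Less s t) \<longleftrightarrow> trm_val e F s < trm_val e F t"
| "sat e F (Neg p) \<longleftrightarrow> \<not> sat e F p"
| "sat e F (And p q) \<longleftrightarrow> sat e F p \<and> sat e F q"
| "sat e F (Or p q) \<longleftrightarrow> sat e F p \<or> sat e F q"
| "sat e F (AllN i p) \<longleftrightarrow> (\<forall>x. sat (e(i := x)) F p)"
| "sat e F (ExN i p) \<longleftrightarrow> (\<exists>x. sat (e(i := x)) F p)"
| "sat e F (AllF i p) \<longleftrightarrow> (\<forall>f. sat e (F(i := f)) p)"
| "sat e F (ExF i p) \<longleftrightarrow> (\<exists>f. sat e (F(i := f)) p)"

primrec arithmetical :: "fml \<Rightarrow> bool" where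
  "arithmetical (Equal s t) \<longleftrightarrow> True"
| "arithmetical (Less s t) \<longleftrightarrow> True"
| "arithmetical (Neg p) \<longleftrightarrow> arithmetical p"
| "arithmetical (And p q) \<longleftrightarrow> arithmetical p \<and> arithmetical q"
| "arithmetical (Or p q) \<longleftrightarrow> arithmetical p \<and> arithmetical q"
| "arithmetical (AllN i p) \<longleftrightarrow> arithmetical p"
| "arithmetical (ExN i p) \<longleftrightarrow> arithmetical p"
| "arithmetical (AllF i p) \<longleftrightarrow> False"
| "arithmetical (ExF i p) \<longleftrightarrow> False"

text \<open>
  \<open>n\<close> alternating blocks of like function quantifiers in front of an arithmetical formula.
\<close>

inductive Sigma1_fml :: "nat \<Rightarrow> fml \<Rightarrow> bool" and Pi1_fml :: "nat \<Rightarrow> fml \<Rightarrow> bool" where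
  Sigma1_arith: "arithmetical p \<Longrightarrow> Sigma1_fml 0 p"
| Pi1_arith: "arithmetical p \<Longrightarrow> Pi1_fml 0 p"
| Sigma1_Pi1: "Pi1_fml n p \<Longrightarrow> Sigma1_fml (Suc n) p"
| Pi1_Sigma1: "Sigma1_fml n p \<Longrightarrow> Pi1_fml (Suc n) p"
| Sigma1_ExF: "Sigma1_fml (Suc n) p \<Longrightarrow> Sigma1_fml (Suc n) (ExF i p)"
| Pi1_AllF: "Pi1_fml (Suc n) p \<Longrightarrow> Pi1_fml (Suc n) (AllF i p)"

text \<open>
  The formula may depend on no variable other than number variable \<open>0\<close>, so the classes are
  parameter-free.
\<close>

definition defines_set :: "fml \<Rightarrow> nat set \<Rightarrow> bool" where
  "defines_set p A \<longleftrightarrow> (\<forall>e F. sat e F p \<longleftrightarrow> e 0 \<in> A)"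

definition Sigma1 :: "nat \<Rightarrow> nat set set" where
  "Sigma1 n = {A. \<exists>p. Sigma1_fml n p \<and> defines_set p A}"

definition Pi1 :: "nat \<Rightarrow> nat set set" where
  "Pi1 n = {A. \<exists>p. Pi1_fml n p \<and> defines_set p A}"

definition E1 :: "nat \<Rightarrow> nat set set" where
  "E1 n = (if odd n then Pi1 n else Sigma1 n)"


section \<open>Numberings and Rogers semilattices\<close>

definition numbering :: "nat set set \<Rightarrow> (nat \<Rightarrow> nat set) \<Rightarrow> bool" where
  "numbering S \<nu> \<longleftrightarrow> range \<nu> = S"

definition E1_computable_numbering :: "nat \<Rightarrow> nat set set \<Rightarrow> (nat \<Rightarrow> nat set) \<Rightarrow> bool" where
  "E1_computable_numbering n S \<nu> \<longleftrightarrow>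
     numbering S \<nu> \<and> {prod_encode (k, x) | k x. x \<in> \<nu> k} \<in> E1 n"

definition E1_computable_family :: "nat \<Rightarrow> nat set set \<Rightarrow> bool" where
  "E1_computable_family n S \<longleftrightarrow> (\<exists>\<nu>. E1_computable_numbering n S \<nu>)"

definition num_le :: "(nat \<Rightarrow> nat set) \<Rightarrow> (nat \<Rightarrow> nat set) \<Rightarrow> bool" where
  "num_le \<nu> \<mu> \<longleftrightarrow> (\<exists>f. computable f \<and> \<nu> = \<mu> \<circ> f)"

definition num_equiv :: "nat \<Rightarrow> nat set set \<Rightarrow> ((nat \<Rightarrow> nat set) \<times> (nat \<Rightarrow> nat set)) set" where
  "num_equiv n S = {(\<nu>, \<mu>). E1_computable_numbering n S \<nu> \<and> E1_computable_numbering n S \<mu> \<and>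
     num_le \<nu> \<mu> \<and> num_le \<mu> \<nu>}"

definition num_join :: "(nat \<Rightarrow> nat set) \<Rightarrow> (nat \<Rightarrow> nat set) \<Rightarrow> nat \<Rightarrow> nat set" where
  "num_join \<nu> \<mu> k = (if even k then \<nu> (k div 2) else \<mu> (k div 2))"

definition rogers :: "nat \<Rightarrow> nat set set \<Rightarrow> (nat \<Rightarrow> nat set) set set" where
  "rogers n S = {\<nu>. E1_computable_numbering n S \<nu>} // num_equiv n S"

definition rogers_le :: "(nat \<Rightarrow> nat set) set \<Rightarrow> (nat \<Rightarrow> nat set) set \<Rightarrow> bool" where
  "rogers_le a b \<longleftrightarrow> (\<exists>\<nu>\<in>a. \<exists>\<mu>\<in>b. num_le \<nu> \<mu>)"

definition rogers_join :: "nat \<Rightarrow> nat set set \<Rightarrow>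
    (nat \<Rightarrow> nat set) set \<Rightarrow> (nat \<Rightarrow> nat set) set \<Rightarrow> (nat \<Rightarrow> nat set) set" where
  "rogers_join n S a b = (\<Union>\<nu>\<in>a. \<Union>\<mu>\<in>b. num_equiv n S `` {num_join \<nu> \<mu>})"

definition weakly_distributive ::
    "'a set \<Rightarrow> ('a \<Rightarrow> 'a \<Rightarrow> bool) \<Rightarrow> ('a \<Rightarrow> 'a \<Rightarrow> 'a) \<Rightarrow> bool" where
  "weakly_distributive A le join \<longleftrightarrow>
     (\<forall>b\<in>A. \<forall>a0\<in>A. \<forall>a1\<in>A. le b (join a0 a1) \<and> \<not> le b a0 \<and> \<not> le b a1 \<longrightarrow>
        (\<exists>b0\<in>A. \<exists>b1\<in>A. b = join b0 b1 \<and> le b0 a0 \<and> le b1 a1))"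

text \<open>The relation on classes does not depend on the chosen representatives.\<close>

lemma computable_id: "computable (\<lambda>x. x)"
  using partial_recursive.pair[OF partial_recursive.left partial_recursive.right]
  by (simp add: computable_def)

lemma computable_comp:
  assumes "computable f" "computable g"
  shows "computable (f \<circ> g)"
proof -
  have "(\<lambda>x. Some (f x)) \<circ>\<^sub>m (\<lambda>x. Some (g x)) = (\<lambda>x. Some ((f \<circ> g) x))"
    by (auto simp: map_comp_def)
  then show ?thesis
    using assms partial_recursive.comp unfolding computable_def by metis
qed

lemma num_le_refl: "num_le \<nu> \<nu>"
  using computable_id by (auto simp: num_le_def comp_def)

lemma num_le_trans: "num_le \<nu> \<mu> \<Longrightarrow> num_le \<mu> \<rho> \<Longrightarrow> num_le \<nu> \<rho>"
  unfolding num_le_def by (metis computable_comp comp_assoc)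

lemma equiv_num_equiv: "equiv {\<nu>. E1_computable_numbering n S \<nu>} (num_equiv n S)"
  by (rule equivI)
    (auto simp: num_equiv_def refl_on_def sym_def trans_def num_le_refl intro: num_le_trans)

lemma rogers_le_classes:
  assumes "E1_computable_numbering n S \<nu>" "E1_computable_numbering n S \<mu>"
  shows "rogers_le (num_equiv n S `` {\<nu>}) (num_equiv n S `` {\<mu>}) \<longleftrightarrow> num_le \<nu> \<mu>"
  using assms unfolding rogers_le_def num_equiv_def
  by (auto intro: num_le_refl) (meson num_le_trans num_le_refl)+

end

theory Submission imports Defs "HOL-Library.Infinite_Set" begin

text \<open>
  Fix a numbering \<open>\<nu>\<close> of \<open>S\<close>. All numberings used have the form \<open>\<nu> \<circ> k\<close>, where \<open>k\<close> belongs to a tuple of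
  functions that is the unique solution of an arithmetical condition; such a reindexing stays
  inside \<open>E1 n\<close>. No information about equality of the sets \<open>\<nu> i\<close> is needed.

  Choose an injective sequence \<open>c\<close> that is cohesive for a countable list of sets derived from all pairs
  of computable functions, and let \<open>\<gamma> (c i) = \<nu> i\<close>, \<open>\<gamma> x = \<nu> 0\<close> elsewhere. Choose \<open>d\<close> such that every
  computable attempt to reduce \<open>\<gamma>\<close> to the numbering \<open>\<gamma>'\<close> with \<open>\<gamma>' (d i) = \<nu> i\<close> hits only finitely many
  \<open>d i\<close>. Let \<open>\<beta>\<^sub>0\<close> take the two values \<open>\<nu> p \<noteq> \<nu> q\<close> according to a noncomputable set. Put
  \<open>\<beta> = \<beta>\<^sub>0 \<oplus> \<gamma>\<close>, \<open>\<alpha>\<^sub>0 = \<beta>\<^sub>0 \<oplus> \<gamma>'\<close>, \<open>\<alpha>\<^sub>1 = \<gamma>\<close>. Then \<open>\<beta> \<le> \<alpha>\<^sub>0 \<oplus> \<alpha>\<^sub>1\<close>. If \<open>\<delta>\<close> is below both \<open>\<beta>\<close> and \<open>\<alpha>\<^sub>0\<close>, then on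
  the indices sent to the odd halves of both joins either \<open>\<delta>\<close> meets only finitely many \<open>\<gamma> (c i)\<close>, or by
  cohesiveness it meets almost all of them and reduces \<open>\<gamma>\<close> to \<open>\<gamma>'\<close> almost everywhere on \<open>c\<close>. The latter
  is impossible, so \<open>\<delta>\<close> has finite range. Hence \<open>\<beta>\<close> is not below \<open>\<alpha>\<^sub>0\<close> and has no splitting. Finally
  \<open>\<beta>\<^sub>0\<close> is not below \<open>\<gamma>\<close>: a reduction with finite trace on \<open>c\<close> would decide the noncomputable set, and one
  with infinite trace would force \<open>S\<close> to be finite.
\<close>

section \<open>Reindexing by implicitly definable functions\<close>

primrec shift_trm :: "nat \<Rightarrow> trm \<Rightarrow> trm" where
  "shift_trm m (NVar i) = NVar (Suc i)"
| "shift_trm m Zero = Zero"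
| "shift_trm m (Succ t) = Succ (shift_trm m t)"
| "shift_trm m (Plus s t) = Plus (shift_trm m s) (shift_trm m t)"
| "shift_trm m (Times s t) = Times (shift_trm m s) (shift_trm m t)"
| "shift_trm m (App i t) = App (i + m) (shift_trm m t)"

primrec shift_fml :: "nat \<Rightarrow> fml \<Rightarrow> fml" where
  "shift_fml m (Equal s t) = Equal (shift_trm m s) (shift_trm m t)"
| "shift_fml m (Less s t) = Less (shift_trm m s) (shift_trm m t)"
| "shift_fml m (Neg p) = Neg (shift_fml m p)"
| "shift_fml m (And p q) = And (shift_fml m p) (shift_fml m q)"
| "shift_fml m (Or p q) = Or (shift_fml m p) (shift_fml m q)"
| "shift_fml m (AllN i p) = AllN (Suc i) (shift_fml m p)"
| "shift_fml m (ExN i p) = ExN (Suc i) (shift_fml m p)"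
| "shift_fml m (AllF i p) = AllF (i + m) (shift_fml m p)"
| "shift_fml m (ExF i p) = ExF (i + m) (shift_fml m p)"

lemma trm_val_shift:
  "trm_val e F (shift_trm m t) = trm_val (\<lambda>i. e (Suc i)) (\<lambda>i. F (i + m)) t"
  by (induction t) auto

lemma fun_upd_Suc_shift: "(\<lambda>i. (e(Suc k := x)) (Suc i)) = (\<lambda>i. e (Suc i))(k := x)"
  by auto

lemma fun_upd_add_shift:
  fixes m :: nat
  shows "(\<lambda>i. (F(k + m := f)) (i + m)) = (\<lambda>i. F (i + m))(k := f)"
  by auto

lemma sat_shift:
  "sat e F (shift_fml m p) \<longleftrightarrow> sat (\<lambda>i. e (Suc i)) (\<lambda>i. F (i + m)) p"
  by (induction p arbitrary: e F)
    (simp_all only: shift_fml.simps sat.simps trm_val_shift fun_upd_Suc_shift fun_upd_add_shift)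

lemma arithmetical_shift: "arithmetical (shift_fml m p) \<longleftrightarrow> arithmetical p"
  by (induction p) auto

text \<open>\<open>A\<close> is applied to the arithmetical matrix below the function quantifiers; the shift leaves
  number variable \<open>0\<close> and the function variables below \<open>m\<close> to the new formula.\<close>

fun map_kernel :: "(fml \<Rightarrow> fml) \<Rightarrow> nat \<Rightarrow> fml \<Rightarrow> fml" where
  "map_kernel A m (AllF i p) = AllF (i + m) (map_kernel A m p)"
| "map_kernel A m (ExF i p) = ExF (i + m) (map_kernel A m p)"
| "map_kernel A m p = A (shift_fml m p)"

lemma map_kernel_arithmetical: "arithmetical p \<Longrightarrow> map_kernel A m p = A (shift_fml m p)"
  by (cases p) auto

lemma map_kernel_level:
  assumes "\<And>p. arithmetical p \<Longrightarrow> arithmetical (A p)"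
  shows "Sigma1_fml n p \<Longrightarrow> Sigma1_fml n (map_kernel A m p)"
    and "Pi1_fml n p \<Longrightarrow> Pi1_fml n (map_kernel A m p)"
  by (induction rule: Sigma1_fml_Pi1_fml.inducts)
    (auto simp: map_kernel_arithmetical arithmetical_shift assms intro: Sigma1_fml_Pi1_fml.intros)

text \<open>The renamed quantifiers of \<open>p\<close> bind only function variables from
  \<open>m\<close> on, so the guard on the variables below \<open>m\<close>, and with it the
  constant \<open>c\<close>, passes through each of them. Number variable 1 is the shifted variable
  0 of \<open>p\<close>, hence \<open>p\<close> is evaluated at the argument
  \<open>z e\<close>.\<close>

lemma sat_map_kernel:
  fixes G :: "nat \<Rightarrow> nat \<Rightarrow> nat"
  assumes "\<And>e F q. sat e F (A q) \<longleftrightarrow>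
    (if \<forall>i<m. F i = G i then sat (e(1 := z e)) F q else c)"
  shows "Sigma1_fml n p \<Longrightarrow> sat e F (map_kernel A m p) \<longleftrightarrow>
      (if \<forall>i<m. F i = G i then sat (\<lambda>i. (e(1 := z e)) (Suc i)) (\<lambda>i. F (i + m)) p else c)"
    and "Pi1_fml n p \<Longrightarrow> sat e F (map_kernel A m p) \<longleftrightarrow>
      (if \<forall>i<m. F i = G i then sat (\<lambda>i. (e(1 := z e)) (Suc i)) (\<lambda>i. F (i + m)) p else c)"
proof (induction arbitrary: F and F rule: Sigma1_fml_Pi1_fml.inducts)
  case (Sigma1_arith p)
  then show ?case by (simp only: map_kernel_arithmetical assms sat_shift)
next
  case (Pi1_arith p)
  then show ?case by (simp only: map_kernel_arithmetical assms sat_shift)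
next
  case (Sigma1_Pi1 n p)
  show ?case by (rule Sigma1_Pi1.IH)
next
  case (Pi1_Sigma1 n p)
  show ?case by (rule Pi1_Sigma1.IH)
next
  case (Sigma1_ExF n p i)
  have "(\<forall>k<m. (F(i + m := f)) k = G k) \<longleftrightarrow> (\<forall>k<m. F k = G k)" for f
    by auto
  then show ?case
    by (simp only: map_kernel.simps sat.simps Sigma1_ExF.IH fun_upd_add_shift) auto
next
  case (Pi1_AllF n p i)
  have "(\<forall>k<m. (F(i + m := f)) k = G k) \<longleftrightarrow> (\<forall>k<m. F k = G k)" for f
    by auto
  then show ?case
    by (simp only: map_kernel.simps sat.simps Pi1_AllF.IH fun_upd_add_shift) auto
qed

section \<open>Prefixes of function quantifiers over a tuple\<close>

primrec AllFs :: "nat \<Rightarrow> fml \<Rightarrow> fml" where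
  "AllFs 0 p = p"
| "AllFs (Suc m) p = AllF m (AllFs m p)"

primrec ExFs :: "nat \<Rightarrow> fml \<Rightarrow> fml" where
  "ExFs 0 p = p"
| "ExFs (Suc m) p = ExF m (ExFs m p)"

lemma sat_AllFs: "sat e F (AllFs m p) \<longleftrightarrow> (\<forall>F'. (\<forall>i\<ge>m. F' i = F i) \<longrightarrow> sat e F' p)"
proof (induction m arbitrary: F)
  case 0
  have "(\<forall>i\<ge>0. F' i = F i) \<longleftrightarrow> F' = F" for F' :: "nat \<Rightarrow> nat \<Rightarrow> nat"
    by auto
  then show ?case by simp
next
  case (Suc m)
  have "(\<forall>i\<ge>Suc m. F' i = F i) \<longleftrightarrow> (\<exists>f. \<forall>i\<ge>m. F' i = (F(m := f)) i)" for F'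
    by (rule iffI, rule exI[of _ "F' m"]) auto
  then show ?case by (simp only: AllFs.simps sat.simps Suc.IH) blast
qed

lemma sat_ExFs: "sat e F (ExFs m p) \<longleftrightarrow> (\<exists>F'. (\<forall>i\<ge>m. F' i = F i) \<and> sat e F' p)"
proof (induction m arbitrary: F)
  case 0
  have "(\<forall>i\<ge>0. F' i = F i) \<longleftrightarrow> F' = F" for F' :: "nat \<Rightarrow> nat \<Rightarrow> nat"
    by auto
  then show ?case by simp
next
  case (Suc m)
  have "(\<forall>i\<ge>Suc m. F' i = F i) \<longleftrightarrow> (\<exists>f. \<forall>i\<ge>m. F' i = (F(m := f)) i)" for F'
    by (rule iffI, rule exI[of _ "F' m"]) auto
  then show ?case by (simp only: ExFs.simps sat.simps Suc.IH) blast
qed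

lemma Pi1_AllFs: "Pi1_fml (Suc n) p \<Longrightarrow> Pi1_fml (Suc n) (AllFs m p)"
  by (induction m) (auto intro: Pi1_AllF)

lemma Sigma1_ExFs: "Sigma1_fml (Suc n) p \<Longrightarrow> Sigma1_fml (Suc n) (ExFs m p)"
  by (induction m) (auto intro: Sigma1_ExF)

text \<open>An arithmetically singled out tuple \<open>G\<close> may be introduced by existential or by universal
  function quantifiers, so reindexing by its components does not leave \<^term>\<open>E1 n\<close>.\<close>

definition implicitly_definable :: "nat \<Rightarrow> (nat \<Rightarrow> nat \<Rightarrow> nat) \<Rightarrow> bool" where
  "implicitly_definable m G \<longleftrightarrow>
     (\<exists>p. arithmetical p \<and> (\<forall>e F. sat e F p \<longleftrightarrow> (\<forall>i<m. F i = G i)))"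

text \<open>Twice the Cantor pairing equation, since terms have no division by 2.\<close>

definition pair_eq :: "trm \<Rightarrow> trm \<Rightarrow> trm \<Rightarrow> fml" where
  "pair_eq s t u =
     Equal (Plus u u) (Plus (Times (Plus s t) (Succ (Plus s t))) (Plus s s))"

lemma sat_pair_eq:
  "sat e F (pair_eq s t u) \<longleftrightarrow> trm_val e F u = prod_encode (trm_val e F s, trm_val e F t)"
proof -
  have "2 * triangle k = k * Suc k" for k
    by (induction k) auto
  then have "2 * prod_encode (a, b) = (a + b) * Suc (a + b) + (a + a)" for a b
    by (simp only: prod_encode_def split add_mult_distrib2)
  note double = this[of "trm_val e F s" "trm_val e F t"]
  show ?thesis
    by (simp only: pair_eq_def sat.simps trm_val.simps double[symmetric]) linarith
qed

text \<open>The guard singles out one tuple, so quantifying the tuple universally or existentially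
  yields the same set. Taking the kind of the leading block of the defining formula lets the new
  prefix merge into that block.\<close>

lemma E1_reindex:
  fixes \<nu> :: "nat \<Rightarrow> nat set"
  assumes G: "implicitly_definable m G" and j: "j < m" and n: "n \<ge> 1"
    and \<nu>: "{prod_encode (k, x) | k x. x \<in> \<nu> k} \<in> E1 n"
  shows "{prod_encode (k, x) | k x. x \<in> \<nu> (G j k)} \<in> E1 n"
proof -
  obtain p where p: "arithmetical p" "\<And>e F. sat e F p \<longleftrightarrow> (\<forall>i<m. F i = G i)"
    using G by (auto simp: implicitly_definable_def)
  define X where "X = {prod_encode (k, x) | k x. x \<in> \<nu> k}"
  define Y where "Y = {prod_encode (k, x) | k x. x \<in> \<nu> (G j k)}"
  define z where "z e = prod_encode (G j (fst (prod_decode (e 0))), snd (prod_decode (e 0)))"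
    for e :: "nat \<Rightarrow> nat"
  have zX: "z e \<in> X \<longleftrightarrow> e 0 \<in> Y" for e
  proof (cases "prod_decode (e 0)")
    case (Pair a b)
    then have "e 0 = prod_encode (a, b)" by (metis prod_decode_inverse)
    then show ?thesis by (auto simp: z_def X_def Y_def)
  qed
  \<comment> \<open>Number variable 0 holds the code of \<open>(k, x)\<close>, and variable 1 is
    forced to be the code of \<open>(G j k, x)\<close>.\<close>
  define \<chi> where "\<chi> = And p (ExN 2 (ExN 3 (And (pair_eq (NVar 2) (NVar 3) (NVar 0))
    (pair_eq (App j (NVar 2)) (NVar 3) (NVar 1)))))"
  have \<chi>: "sat e F \<chi> \<longleftrightarrow> (\<forall>i<m. F i = G i) \<and> e 1 = z e" for e F
  proof -
    have "(\<exists>x y. a = prod_encode (x, y) \<and> b = prod_encode (g x, y)) \<longleftrightarrow>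
        b = prod_encode (g (fst (prod_decode a)), snd (prod_decode a))" for a b and g :: "nat \<Rightarrow> nat"
      by (metis prod_encode_inverse prod_decode_inverse fst_conv snd_conv prod.collapse)
    then show ?thesis
      using j by (simp add: \<chi>_def p sat_pair_eq z_def) metis
  qed
  have ar: "arithmetical \<chi>" using p by (simp add: \<chi>_def pair_eq_def)
  \<comment> \<open>On the right tuple \<open>A\<close> and \<open>B\<close> agree because
    \<open>\<chi>\<close> determines variable 1. On all others they default to True and False, which
    are neutral under the universal and the existential prefix.\<close>
  define A where "A q = AllN 1 (Or (Neg \<chi>) q)" for q
  define B where "B q = ExN 1 (And \<chi> q)" for q
  have z_upd: "z (e(Suc 0 := x)) = z e" for e x
    by (simp add: z_def)
  have satA: "sat e F (A q) \<longleftrightarrow> (if \<forall>i<m. F i = G i then sat (e(1 := z e)) F q else True)" for e F q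
    by (auto simp: A_def \<chi> z_upd)
  have satB: "sat e F (B q) \<longleftrightarrow> (if \<forall>i<m. F i = G i then sat (e(1 := z e)) F q else False)" for e F q
    by (auto simp: B_def \<chi> z_upd)
  have ext: "\<exists>F'. (\<forall>i\<ge>m. F' i = F i) \<and> (\<forall>i<m. F' i = G i)" for F
    by (rule exI[of _ "\<lambda>i. if i < m then G i else F i"]) auto
  obtain n' where n': "n = Suc n'" using n by (cases n) auto
  have "Y \<in> E1 n"
  proof (cases "odd n")
    case True
    then obtain q where q: "Pi1_fml n q" "defines_set q X"
      using \<nu> unfolding X_def[symmetric] by (auto simp: E1_def Pi1_def)
    have "sat e F (AllFs m (map_kernel A m q)) \<longleftrightarrow> e 0 \<in> Y" for e F
      unfolding sat_AllFs sat_map_kernel(2)[OF satA q(1)]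
      using q(2) ext[of F] zX[of e] by (auto simp: defines_set_def)
    moreover have "Pi1_fml n (AllFs m (map_kernel A m q))"
      using map_kernel_level(2)[OF _ q(1), of A m] ar
      by (auto simp: n' A_def intro: Pi1_AllFs)
    ultimately show ?thesis using True by (auto simp: E1_def Pi1_def defines_set_def)
  next
    case False
    then obtain q where q: "Sigma1_fml n q" "defines_set q X"
      using \<nu> unfolding X_def[symmetric] by (auto simp: E1_def Sigma1_def)
    have "sat e F (ExFs m (map_kernel B m q)) \<longleftrightarrow> e 0 \<in> Y" for e F
      unfolding sat_ExFs sat_map_kernel(1)[OF satB q(1)]
      using q(2) ext[of F] zX[of e] by (auto simp: defines_set_def)
    moreover have "Sigma1_fml n (ExFs m (map_kernel B m q))"
      using map_kernel_level(1)[OF _ q(1), of B m] ar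
      by (auto simp: n' B_def intro: Sigma1_ExFs)
    ultimately show ?thesis using False by (auto simp: E1_def Sigma1_def defines_set_def)
  qed
  then show ?thesis by (simp add: Y_def)
qed

section \<open>Computable functions\<close>

lemma computable_succ: "computable Suc"
  using partial_recursive.succ by (simp add: computable_def)

lemma computable_fst: "computable (\<lambda>x. fst (prod_decode x))"
  using partial_recursive.left by (simp add: computable_def)

lemma computable_snd: "computable (\<lambda>x. snd (prod_decode x))"
  using partial_recursive.right by (simp add: computable_def)

lemma computable_compose: "computable f \<Longrightarrow> computable g \<Longrightarrow> computable (\<lambda>x. f (g x))"
  using computable_comp[of f g] by (simp add: comp_def)

lemma computable_pair:
  "computable f \<Longrightarrow> computable g \<Longrightarrow> computable (\<lambda>x. prod_encode (f x, g x))"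
  using partial_recursive.pair[of "\<lambda>x. Some (f x)" "\<lambda>x. Some (g x)"]
  by (simp add: computable_def)

lemma computable_const: "computable (\<lambda>x. k)"
proof (induction k)
  case 0
  show ?case using partial_recursive.zero by (simp add: computable_def)
next
  case (Suc k)
  show ?case by (rule computable_compose[OF computable_succ Suc])
qed

lemma computable_rec_nat:
  assumes "computable f" "computable g" "computable a" "computable m"
  shows "computable (\<lambda>x. rec_nat (f (a x)) (\<lambda>k i. g (prod_encode (a x, prod_encode (k, i)))) (m x))"
proof -
  have "prim_rec (\<lambda>x. Some (f x)) (\<lambda>x. Some (g x)) u l =
      Some (rec_nat (f u) (\<lambda>k i. g (prod_encode (u, prod_encode (k, i)))) l)" for u l
    by (induction l) auto
  then have "computable (\<lambda>x. rec_nat (f (fst (prod_decode x)))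
      (\<lambda>k i. g (prod_encode (fst (prod_decode x), prod_encode (k, i)))) (snd (prod_decode x)))"
    using partial_recursive.prec[of "\<lambda>x. Some (f x)" "\<lambda>x. Some (g x)"] assms(1,2)
    by (simp add: computable_def)
  from computable_compose[OF this computable_pair[OF assms(3,4)]]
  show ?thesis by simp
qed

lemma computable_case_nat:
  assumes "computable f" "computable g" "computable m"
  shows "computable (\<lambda>x. case m x of 0 \<Rightarrow> f x | Suc k \<Rightarrow> g (prod_encode (x, k)))"
proof -
  have *: "computable (\<lambda>z. g (prod_encode (fst (prod_decode z), fst (prod_decode (snd (prod_decode z))))))"
    by (intro computable_compose[OF assms(2)] computable_pair computable_fst
        computable_compose[OF computable_fst computable_snd])
  have "rec_nat a (\<lambda>k i. h k) l = (case l of 0 \<Rightarrow> a | Suc k \<Rightarrow> h k)" for a :: nat and h l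
    by (cases l) auto
  then show ?thesis
    using computable_rec_nat[OF assms(1) * computable_id assms(3)] by simp
qed

lemma computable_double: "computable (\<lambda>x. 2 * x)"
proof -
  have "rec_nat 0 (\<lambda>k i. Suc (Suc i)) x = 2 * x" for x
    by (induction x) auto
  moreover have "computable (\<lambda>z. Suc (Suc (snd (prod_decode (snd (prod_decode z))))))"
    by (intro computable_compose[OF computable_succ] computable_compose[OF computable_snd]
        computable_snd)
  ultimately show ?thesis
    using computable_rec_nat[OF computable_const[of 0] _ computable_id computable_id] by fastforce
qed

lemma computable_mod_2: "computable (\<lambda>x. x mod 2)"
proof -
  have "rec_nat 0 (\<lambda>k i. case i of 0 \<Rightarrow> 1 | Suc l \<Rightarrow> 0) x = x mod 2" for x
    by (induction x) (auto simp: mod_Suc split: nat.split)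
  moreover have "computable (\<lambda>z. case snd (prod_decode (snd (prod_decode z))) of 0 \<Rightarrow> 1 | Suc l \<Rightarrow> 0)"
    by (intro computable_case_nat computable_const computable_compose[OF computable_snd computable_snd])
  ultimately show ?thesis
    using computable_rec_nat[OF computable_const[of 0] _ computable_id computable_id, of "\<lambda>z. case snd (prod_decode (snd (prod_decode z))) of 0 \<Rightarrow> 1 | Suc l \<Rightarrow> 0"] by simp
qed

lemma computable_eventually_const:
  assumes "\<And>x. x \<ge> N \<Longrightarrow> f x = k"
  shows "computable f"
  using assms
proof (induction N arbitrary: f)
  case 0
  then have "f = (\<lambda>x. k)" by auto
  then show ?case using computable_const by simp
next
  case (Suc N)
  have "computable (\<lambda>x. f (Suc x))"
    by (rule Suc.IH) (simp add: Suc.prems)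
  then have "computable (\<lambda>x. case x of 0 \<Rightarrow> f 0 | Suc l \<Rightarrow> f (Suc (snd (prod_decode (prod_encode (x, l))))))"
    by (intro computable_case_nat[OF computable_const _ computable_id] computable_compose[OF _ computable_snd])
  moreover have "(\<lambda>x. case x of 0 \<Rightarrow> f 0 | Suc l \<Rightarrow> f (Suc (snd (prod_decode (prod_encode (x, l)))))) = f"
    by (auto split: nat.split)
  ultimately show ?case by simp
qed

section \<open>A universal function\<close>

text \<open>Termination of \<open>univ\<close> rests on this: a nonzero tag makes the body smaller
  than the whole code, and all tags that recurse are nonzero.\<close>

lemma snd_prod_decode_less: "fst (prod_decode c) > 0 \<Longrightarrow> snd (prod_decode c) < c"
proof -
  assume *: "fst (prod_decode c) > 0"
  obtain a b where ab: "prod_decode c = (a, b)" by (cases "prod_decode c")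
  have "k \<le> triangle k" for k by (induction k) auto
  from this[of "a + b"] have "b < prod_encode (a, b)"
    using * ab by (simp add: prod_encode_def)
  then show ?thesis using ab by (metis prod_decode_inverse snd_conv)
qed

lemma prod_decode_le: "fst (prod_decode c) \<le> c" "snd (prod_decode c) \<le> c"
  by (metis le_prod_encode_1 prod.collapse prod_decode_inverse)
     (metis le_prod_encode_2 prod.collapse prod_decode_inverse)

text \<open>Tags 0 to 3 are the initial functions and 4 to 6 the closure rules other than search.
  All tags from 7 on mean search, so every number is a code.\<close>

function univ :: "nat \<Rightarrow> nat \<rightharpoonup> nat" where
  "univ c = (let t = fst (prod_decode c); y = snd (prod_decode c);
      a = fst (prod_decode y); b = snd (prod_decode y) in
    if t = 0 then (\<lambda>_. Some 0)
    else if t = 1 then (\<lambda>x. Some (Suc x))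
    else if t = 2 then (\<lambda>x. Some (fst (prod_decode x)))
    else if t = 3 then (\<lambda>x. Some (snd (prod_decode x)))
    else if t = 4 then (\<lambda>x. case univ a x of None \<Rightarrow> None
      | Some u \<Rightarrow> (case univ b x of None \<Rightarrow> None | Some v \<Rightarrow> Some (prod_encode (u, v))))
    else if t = 5 then univ a \<circ>\<^sub>m univ b
    else if t = 6 then (\<lambda>x. prim_rec (univ a) (univ b) (fst (prod_decode x)) (snd (prod_decode x)))
    else mu_search (univ y))"
  by pat_completeness auto
termination
  by (relation "measure id")
    (auto intro: snd_prod_decode_less
      le_less_trans[OF prod_decode_le(1) snd_prod_decode_less]
      le_less_trans[OF prod_decode_le(2) snd_prod_decode_less])

declare univ.simps [simp del]

lemma partial_recursive_univ: "partial_recursive f \<Longrightarrow> \<exists>c. univ c = f"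
proof (induction rule: partial_recursive.induct)
  case zero
  show ?case by (rule exI[of _ "prod_encode (0, 0)"]) (simp add: univ.simps)
next
  case succ
  show ?case by (rule exI[of _ "prod_encode (1, 0)"]) (simp add: univ.simps)
next
  case left
  show ?case by (rule exI[of _ "prod_encode (2, 0)"]) (simp add: univ.simps)
next
  case right
  show ?case by (rule exI[of _ "prod_encode (3, 0)"]) (simp add: univ.simps)
next
  case (pair f g)
  then obtain a b where "f = univ a" "g = univ b" by auto
  then show ?case unfolding \<open>f = univ a\<close> \<open>g = univ b\<close>
    by (intro exI[of _ "prod_encode (4, prod_encode (a, b))"])
      (simp add: univ.simps[of "prod_encode (4, prod_encode (a, b))"])
next
  case (comp f g)
  then obtain a b where "f = univ a" "g = univ b" by auto
  then show ?case
    by (intro exI[of _ "prod_encode (5, prod_encode (a, b))"])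
      (simp add: univ.simps[of "prod_encode (5, prod_encode (a, b))"])
next
  case (prec f g)
  then obtain a b where "f = univ a" "g = univ b" by auto
  then show ?case
    by (intro exI[of _ "prod_encode (6, prod_encode (a, b))"])
      (simp add: univ.simps[of "prod_encode (6, prod_encode (a, b))"])
next
  case (search f)
  then obtain a where "f = univ a" by auto
  then show ?case
    by (intro exI[of _ "prod_encode (7, a)"]) (simp add: univ.simps[of "prod_encode (7, a)"])
qed

text \<open>\<open>0\<close> stands for divergence.\<close>

definition uval :: "nat \<Rightarrow> nat \<Rightarrow> nat" where
  "uval c x = (case univ c x of None \<Rightarrow> 0 | Some y \<Rightarrow> Suc y)"

lemma computable_uval:
  assumes "computable f"
  obtains c where "\<And>x. uval c x = Suc (f x)"
proof -
  obtain c where "univ c = (\<lambda>x. Some (f x))"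
    using partial_recursive_univ assms unfolding computable_def by blast
  then show thesis by (intro that[of c]) (simp add: uval_def)
qed

section \<open>The cohesive sequence and the numberings\<close>

text \<open>\<open>j\<close> codes a pair of reductions \<open>f\<close>, \<open>g\<close>; \<open>reach j x w\<close> says that a common index is sent by \<open>f\<close>
  to \<open>x\<close> and by \<open>g\<close> to \<open>w\<close> in the odd halves of two joins.\<close>

definition reach :: "nat \<Rightarrow> nat \<Rightarrow> nat \<Rightarrow> bool" where
  "reach j x w \<longleftrightarrow> (\<exists>y. uval (fst (prod_decode j)) y = Suc (Suc (2 * x)) \<and>
     uval (snd (prod_decode j)) y = Suc (Suc (2 * w)))"

definition rval :: "nat \<Rightarrow> nat \<Rightarrow> nat" where
  "rval j x = (if \<exists>w. reach j x w then Suc (LEAST w. reach j x w) else 0)"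

text \<open>Since \<open>rval j\<close> is single-valued, these sets partition the numbers for each
  fixed \<open>j\<close>: \<open>k = 0\<close> is where nothing is reached,
  \<open>k = Suc k'\<close> is where the selected value lies in column \<open>k'\<close> of the
  Cantor pairing.\<close>

definition piece :: "nat \<Rightarrow> nat \<Rightarrow> bool" where
  "piece e x \<longleftrightarrow> (case prod_decode e of (j, k) \<Rightarrow>
     (k = 0 \<and> rval j x = 0) \<or> (\<exists>k' b. k = Suc k' \<and> rval j x = Suc (prod_encode (k', b))))"

lemma rval_eq_0_iff: "rval j x = 0 \<longleftrightarrow> (\<forall>w. \<not> reach j x w)"
  by (simp add: rval_def)

lemma rval_Suc_reach: "rval j x = Suc w \<Longrightarrow> reach j x w"
  by (auto simp: rval_def split: if_splits intro: LeastI)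

lemma rval_eq_Suc_iff: "rval j x = Suc w \<longleftrightarrow> reach j x w \<and> (\<forall>v<w. \<not> reach j x v)"
  by (auto simp: rval_def intro: LeastI dest: not_less_Least intro!: Least_equality)
    (metis not_le_imp_less)

section \<open>Construction of the cohesive sequence\<close>

fun side :: "nat \<Rightarrow> nat" where
  "side i = (if infinite {x. (\<forall>e\<in>{..<i}. piece e x \<longleftrightarrow> side e = 0) \<and> piece i x} then 0 else 1)"

declare side.simps [simp del]

definition cell :: "nat \<Rightarrow> nat set" where
  "cell i = {x. \<forall>e<i. piece e x \<longleftrightarrow> side e = 0}"

text \<open>\<open>piece i\<close> splits an infinite cell into two parts, one of them infinite;
  \<open>side i\<close> keeps the part inside \<open>piece i\<close> exactly when that part is
  infinite.\<close>

lemma infinite_cell: "infinite (cell i)"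
proof (induction i)
  case 0
  then show ?case by (simp add: cell_def)
next
  case (Suc i)
  have side: "side i = (if infinite (cell i \<inter> {x. piece i x}) then 0 else 1)"
    by (subst side.simps) (simp only: cell_def Collect_conj_eq lessThan_iff Ball_def)
  have "cell (Suc i) = cell i \<inter> {x. piece i x \<longleftrightarrow> side i = 0}"
    by (auto simp: cell_def less_Suc_eq)
  moreover have "cell i = (cell i \<inter> {x. piece i x}) \<union> (cell i \<inter> {x. \<not> piece i x})"
    by auto
  then have "infinite (cell i \<inter> {x. piece i x}) \<or> infinite (cell i \<inter> {x. \<not> piece i x})"
    using Suc by (metis finite_Un)
  ultimately show ?case using side by auto
qed

fun coh :: "nat \<Rightarrow> nat" where
  "coh i = (LEAST x. x \<in> cell i \<and> (\<forall>j\<in>{..<i}. coh j \<noteq> x))"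

declare coh.simps [simp del]

lemma coh_exists: "\<exists>x. x \<in> cell i \<and> (\<forall>j\<in>{..<i}. f j \<noteq> x)"
proof -
  have "infinite (cell i - f ` {..<i})"
    using infinite_cell by simp
  then obtain x where "x \<in> cell i - f ` {..<i}"
    by (metis ex_in_conv finite.emptyI)
  then show ?thesis by blast
qed

lemma coh_props: "coh i \<in> cell i" "j < i \<Longrightarrow> coh j \<noteq> coh i"
  using LeastI_ex[OF coh_exists[of i coh]] by (simp_all add: coh.simps[of i, symmetric])

lemma inj_coh: "inj coh"
  by (rule injI) (metis coh_props(2) linorder_neqE_nat)

text \<open>\<open>coh i\<close> lies in \<open>cell i\<close>, and for \<open>i > e\<close> this
  cell has already settled membership in \<open>piece e\<close> as prescribed by
  \<open>side e\<close>.\<close>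

lemma coh_cohesive: "(\<forall>i>e. piece e (coh i)) \<or> (\<forall>i>e. \<not> piece e (coh i))"
  using coh_props(1) by (auto simp: cell_def)

section \<open>A sequence evading the selected values\<close>

definition avoids :: "nat \<Rightarrow> nat \<Rightarrow> bool" where
  "avoids i z \<longleftrightarrow> (\<forall>j\<le>i. \<forall>m. rval j (coh m) \<noteq> Suc z)"

text \<open>Along the cohesive sequence the pair \<open>j\<close> can select \<open>dia l\<close>
  only for \<open>l < j\<close>, because \<open>avoids l\<close> covers all codes up to
  \<open>l\<close>.\<close>

fun dia :: "nat \<Rightarrow> nat" where
  "dia i = (LEAST z. avoids i z \<and> (\<forall>j\<in>{..<i}. dia j \<noteq> z))"

declare dia.simps [simp del]

text \<open>Each \<open>j \<le> i\<close> sends almost all of the cohesive sequence into at most one column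
  \<open>{prod_encode (k, b) | b}\<close>, so some column is met only finitely often.\<close>

lemma dia_exists: "\<exists>z. avoids i z \<and> (\<forall>j\<in>{..<i}. f j \<noteq> z)"
proof -
  \<comment> \<open>By cohesiveness a column is either full for \<open>j\<close> or missed by almost
    all of the sequence. \<open>prod_encode (j, Suc k)\<close> is the index of the piece and also
    the stage from which it is decided.\<close>
  define full where "full j k \<longleftrightarrow> (\<forall>m>prod_encode (j, Suc k). piece (prod_encode (j, Suc k)) (coh m))" for j k
  have full_unique: "k = k'" if "full j k" "full j k'" for j k k'
  proof -
    define m where "m = Suc (prod_encode (j, Suc k) + prod_encode (j, Suc k'))"
    have "piece (prod_encode (j, Suc k)) (coh m)" "piece (prod_encode (j, Suc k')) (coh m)"
      using that by (auto simp: full_def m_def)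
    then show ?thesis by (auto simp: piece_def)
  qed
  define K where "K j = (THE k. full j k)" for j
  obtain k where k: "k \<notin> K ` {..i}"
    using ex_new_if_finite[of "K ` {..i}"] infinite_UNIV_nat by blast
  have nk: "\<not> full j k" if "j \<le> i" for j
  proof
    assume "full j k"
    then have "K j = k" unfolding K_def using full_unique by blast
    then show False using k that by blast
  qed
  have late: "rval j (coh m) \<noteq> Suc (prod_encode (k, b))" if "j \<le> i" "m > prod_encode (j, Suc k)" for j m b
  proof -
    have "\<not> piece (prod_encode (j, Suc k)) (coh m)"
      using nk[OF that(1)] coh_cohesive[of "prod_encode (j, Suc k)"] that(2) by (auto simp: full_def)
    then show ?thesis by (simp add: piece_def)
  qed
  \<comment> \<open>The finitely many obstacles inside the chosen infinite column, shifted by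
    \<open>Suc\<close>: values selected before cohesiveness takes effect, and the points already
    used.\<close>
  define B where "B = (\<Union>j\<in>{..i}. (\<lambda>m. rval j (coh m)) ` {..prod_encode (j, Suc k)}) \<union> (\<lambda>j. Suc (f j)) ` {..<i}"
  have "finite B" by (simp add: B_def)
  moreover have "infinite (range (\<lambda>b. Suc (prod_encode (k, b))))"
    by (intro notI) (use finite_imageD[of "\<lambda>b. Suc (prod_encode (k, b))" UNIV] in \<open>simp add: inj_on_def\<close>)
  ultimately have "infinite (range (\<lambda>b. Suc (prod_encode (k, b))) - B)"
    by simp
  then have "range (\<lambda>b. Suc (prod_encode (k, b))) - B \<noteq> {}"
    by (metis finite.emptyI)
  then obtain b where b: "Suc (prod_encode (k, b)) \<notin> B"
    by blast
  have "avoids i (prod_encode (k, b))"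
    unfolding avoids_def
  proof (intro allI impI)
    fix j m
    assume "j \<le> i"
    show "rval j (coh m) \<noteq> Suc (prod_encode (k, b))"
    proof (cases "m > prod_encode (j, Suc k)")
      case True
      then show ?thesis using late \<open>j \<le> i\<close> by simp
    next
      case False
      then have "rval j (coh m) \<in> (\<lambda>m. rval j (coh m)) ` {..prod_encode (j, Suc k)}" by simp
      then have "rval j (coh m) \<in> B" using \<open>j \<le> i\<close> unfolding B_def by blast
      then show ?thesis using b by auto
    qed
  qed
  moreover have "\<forall>j\<in>{..<i}. f j \<noteq> prod_encode (k, b)"
  proof
    fix j
    assume "j \<in> {..<i}"
    then have "Suc (f j) \<in> B" by (simp add: B_def)
    then show "f j \<noteq> prod_encode (k, b)" using b by auto
  qed
  ultimately show ?thesis by blast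
qed

lemma dia_props: "avoids i (dia i)" "j < i \<Longrightarrow> dia j \<noteq> dia i"
  using LeastI_ex[OF dia_exists[of i dia]] by (simp_all add: dia.simps[of i, symmetric])

lemma inj_dia: "inj dia"
  by (rule injI) (metis dia_props(2) linorder_neqE_nat)

text \<open>Followed by \<open>\<nu>\<close>, the cases \<open>s = coh\<close> and
  \<open>s = dia\<close> are the numberings \<open>\<gamma>\<close> and \<open>\<gamma>'\<close>;
  the default 0 gives \<open>\<nu> 0\<close> off the sequence.\<close>

definition left_inv0 :: "(nat \<Rightarrow> nat) \<Rightarrow> nat \<Rightarrow> nat" where
  "left_inv0 s x = (if x \<in> range s then inv s x else 0)"

lemma left_inv0_apply: "inj s \<Longrightarrow> left_inv0 s (s i) = i"
  by (simp add: left_inv0_def)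

lemma left_inv0_cases: "inj s \<Longrightarrow> left_inv0 s x = 0 \<or> (\<exists>i. x = s i \<and> left_inv0 s x = i)"
  by (auto simp: left_inv0_def)

lemma surj_left_inv0: "inj s \<Longrightarrow> surj (left_inv0 s)"
  by (metis left_inv0_apply surjI)

text \<open>The set \<open>{x. univ x x = Some 0}\<close> has no computable characteristic function.\<close>

definition diag :: "nat \<Rightarrow> nat \<Rightarrow> nat \<Rightarrow> nat" where
  "diag p q x = (if uval x x = 1 then p else q)"

definition fjoin :: "(nat \<Rightarrow> nat) \<Rightarrow> (nat \<Rightarrow> nat) \<Rightarrow> nat \<Rightarrow> nat" where
  "fjoin f g k = (if even k then f (k div 2) else g (k div 2))"

lemma num_join_fjoin: "num_join (\<nu> \<circ> f) (\<nu> \<circ> g) = \<nu> \<circ> fjoin f g"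
  by (rule ext) (simp add: num_join_def fjoin_def)

lemma surj_fjoin: "surj g \<Longrightarrow> surj (fjoin f g)"
  by (rule surjI[of _ "\<lambda>y. Suc (2 * inv g y)"]) (simp add: fjoin_def surj_f_inv_f)

lemma no_common_lower_bound:
  fixes \<nu> :: "nat \<Rightarrow> nat set"
  assumes inf: "infinite (range \<nu>)"
    and f: "computable f" and g: "computable g"
    and fg: "\<nu> \<circ> fjoin (diag p q) (left_inv0 coh) \<circ> f = \<nu> \<circ> fjoin (diag p q) (left_inv0 dia) \<circ> g"
  shows "finite (range (\<nu> \<circ> fjoin (diag p q) (left_inv0 coh) \<circ> f))"
proof -
  let ?\<delta> = "\<nu> \<circ> fjoin (diag p q) (left_inv0 coh) \<circ> f"
  obtain a where a: "\<And>x. uval a x = Suc (f x)" using computable_uval[OF f] by blast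
  obtain b where b: "\<And>x. uval b x = Suc (g x)" using computable_uval[OF g] by blast
  define j where "j = prod_encode (a, b)"
  define N where "N = prod_encode (j, 0)"
  have reach: "reach j x w \<longleftrightarrow> (\<exists>y. f y = Suc (2 * x) \<and> g y = Suc (2 * w))" for x w
    by (simp add: reach_def j_def a b)
  have \<delta>_f: "?\<delta> y = \<nu> (fjoin (diag p q) (left_inv0 coh) (f y))" for y
    by simp
  have \<delta>_g: "?\<delta> y = \<nu> (fjoin (diag p q) (left_inv0 dia) (g y))" for y
    using fun_cong[OF fg, of y] by simp
  have piece0: "piece N x \<longleftrightarrow> (\<forall>w. \<not> reach j x w)" for x
    by (simp add: piece_def N_def rval_eq_0_iff)
  consider "\<forall>i>N. piece N (coh i)" | "\<forall>i>N. \<not> piece N (coh i)"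
    using coh_cohesive by blast
  then show ?thesis
  proof cases
    case 1
    \<comment> \<open>An even value of \<open>f\<close> or \<open>g\<close> leads to
      \<open>\<nu> p\<close> or \<open>\<nu> q\<close>. Two odd values make their \<open>x\<close>
      reached, so \<open>x\<close> is no \<open>coh i\<close> with \<open>i > N\<close>.\<close>
    have "?\<delta> y \<in> {\<nu> p, \<nu> q, \<nu> 0} \<union> \<nu> ` {..N}" for y
    proof (cases "even (f y) \<or> even (g y)")
      case True
      then show ?thesis
      proof
        assume "even (f y)"
        then show ?thesis unfolding \<delta>_f by (simp add: fjoin_def diag_def)
      next
        assume "even (g y)"
        then show ?thesis unfolding \<delta>_g by (simp add: fjoin_def diag_def)
      qed
    next
      case False
      then obtain x w where xw: "f y = Suc (2 * x)" "g y = Suc (2 * w)"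
        by (metis oddE Suc_eq_plus1)
      then have "reach j x w" using reach by blast
      then have "x \<noteq> coh i" if "i > N" for i
        using 1 that piece0 by blast
      then have "left_inv0 coh x \<in> insert 0 {..N}"
        using left_inv0_cases[OF inj_coh, of x] by (metis atMost_iff insertCI not_le_imp_less)
      then show ?thesis
        using \<delta>_f[of y] xw by (auto simp: fjoin_def)
    qed
    then have "range ?\<delta> \<subseteq> {\<nu> p, \<nu> q, \<nu> 0} \<union> \<nu> ` {..N}" by blast
    then show ?thesis by (rule finite_subset) simp
  next
    case 2
    \<comment> \<open>Almost every \<open>coh i\<close> is reached, and its selected
      \<open>w\<close> satisfies \<open>\<nu> i = \<nu> (left_inv0 dia w)\<close>. Since
      \<open>w\<close> is no \<open>dia l\<close> with \<open>l \<ge> j\<close>,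
      \<open>\<nu>\<close> itself would have finite range.\<close>
    have "\<nu> i \<in> insert (\<nu> 0) (\<nu> ` ({..N} \<union> {..<j}))" for i
    proof (cases "i > N")
      case True
      then have "rval j (coh i) \<noteq> 0" using 2 piece0 rval_eq_0_iff by metis
      then obtain w where w: "rval j (coh i) = Suc w" by (metis not0_implies_Suc)
      then obtain y where y: "f y = Suc (2 * coh i)" "g y = Suc (2 * w)"
        using rval_Suc_reach reach by blast
      have "\<nu> i = \<nu> (left_inv0 dia w)"
        using \<delta>_f[of y] \<delta>_g[of y] y left_inv0_apply[OF inj_coh, of i] by (simp add: fjoin_def)
      moreover have "w \<noteq> dia l" if "l \<ge> j" for l
        using dia_props(1)[of l] w that by (auto simp: avoids_def)
      then have "left_inv0 dia w \<in> insert 0 {..<j}"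
        using left_inv0_cases[OF inj_dia, of w] by (metis insertCI lessThan_iff not_le_imp_less)
      ultimately show ?thesis by auto
    next
      case False
      then show ?thesis by auto
    qed
    then have "range \<nu> \<subseteq> insert (\<nu> 0) (\<nu> ` ({..N} \<union> {..<j}))" by blast
    then have "finite (range \<nu>)" by (rule finite_subset) simp
    then show ?thesis using inf by blast
  qed
qed

lemma diag_not_below_cohesive:
  fixes \<nu> :: "nat \<Rightarrow> nat set"
  assumes inf: "infinite (range \<nu>)" and pq: "\<nu> p \<noteq> \<nu> q" and f: "computable f"
  shows "\<nu> \<circ> diag p q \<noteq> \<nu> \<circ> left_inv0 coh \<circ> f"
proof
  assume eq: "\<nu> \<circ> diag p q = \<nu> \<circ> left_inv0 coh \<circ> f"
  then have eq': "\<nu> (diag p q x) = \<nu> (left_inv0 coh (f x))" for x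
    by (metis comp_apply)
  \<comment> \<open>Pairing \<open>Suc (2 * f y)\<close> with the constant 1 turns reachability into
    membership in \<open>range f\<close>, so the sequence is cohesive for
    \<open>range f\<close>.\<close>
  have "computable (\<lambda>y. Suc (2 * f y))"
    by (intro computable_compose[OF computable_succ] computable_compose[OF computable_double] f)
  then obtain a where a: "\<And>x. uval a x = Suc (Suc (2 * f x))" using computable_uval by blast
  obtain b where b: "\<And>x. uval b x = Suc (Suc (2 * 0))"
    using computable_uval[OF computable_const[of 1]] by auto
  define j where "j = prod_encode (a, b)"
  define N where "N = prod_encode (j, 0)"
  have piece0: "piece N x \<longleftrightarrow> x \<notin> range f" for x
    by (auto simp: piece_def N_def rval_eq_0_iff reach_def j_def a b)
  consider "\<forall>i>N. piece N (coh i)" | "\<forall>i>N. \<not> piece N (coh i)"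
    using coh_cohesive by blast
  then show False
  proof cases
    case 1
    define M where "M = Suc (Max (coh ` {..N}))"
    have tail: "left_inv0 coh (f x) = 0" if "f x \<ge> M" for x
    proof (rule ccontr)
      assume "left_inv0 coh (f x) \<noteq> 0"
      then obtain i where i: "f x = coh i" using left_inv0_cases[OF inj_coh] by metis
      then have "i \<le> N" using 1 piece0 by (metis not_le_imp_less rangeI)
      then have "coh i \<le> Max (coh ` {..N})" by simp
      then show False using i that by (simp add: M_def)
    qed
    \<comment> \<open>\<open>\<chi>\<close> is constant from \<open>M\<close> on, hence computable,
      and \<open>\<chi> (f x)\<close> decides whether \<open>diag p q x = p\<close>. Evaluating at a
      code \<open>c\<close> of this very decision procedure contradicts the choice of
      \<open>diag\<close>.\<close>
    define \<chi> where "\<chi> v = (if \<nu> (if v < M then left_inv0 coh v else 0) = \<nu> p then 1 else 0 :: nat)" for v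
    have "computable \<chi>"
      by (rule computable_eventually_const[of M _ "\<chi> M"]) (simp add: \<chi>_def)
    then obtain c where c: "\<And>x. uval c x = Suc (\<chi> (f x))"
      using computable_uval[OF computable_compose[OF _ f]] by blast
    have "\<chi> (f x) = (if \<nu> (left_inv0 coh (f x)) = \<nu> p then 1 else 0)" for x
      using tail[of x] by (simp add: \<chi>_def)
    then have "\<chi> (f c) = (if diag p q c = p then 1 else 0)"
      using eq'[of c] pq by (auto simp: diag_def)
    then show False using c[of c] pq by (auto simp: diag_def split: if_splits)
  next
    case 2
    have "\<nu> i \<in> {\<nu> p, \<nu> q} \<union> \<nu> ` {..N}" for i
    proof (cases "i > N")
      case True
      then obtain y where "coh i = f y" using 2 piece0 by blast
      then have "\<nu> i = \<nu> (diag p q y)"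
        using eq'[of y] left_inv0_apply[OF inj_coh, of i] by simp
      then show ?thesis by (auto simp: diag_def)
    next
      case False
      then show ?thesis by auto
    qed
    then have "range \<nu> \<subseteq> {\<nu> p, \<nu> q} \<union> \<nu> ` {..N}" by blast
    then have "finite (range \<nu>)" by (rule finite_subset) simp
    then show False using inf by blast
  qed
qed

section \<open>Implicit arithmetical definitions\<close>

text \<open>Unlike \<^const>\<open>prod_encode\<close>, this pairing is the value of a term. A function variable for
  \<open>pairf\<close> then makes \<^const>\<open>prod_encode\<close> expressible by terms as well.\<close>

definition sqpair :: "nat \<times> nat \<Rightarrow> nat" where
  "sqpair = (\<lambda>(a, b). (a + b) * (a + b) + a)"

text \<open>The value lies between the square of \<open>a + b\<close> and the next square, so it
  determines the sum and then \<open>a\<close>.\<close>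

lemma inj_sqpair: "inj sqpair"
proof (rule injI, clarify)
  fix a b c d
  assume eq: "sqpair (a, b) = sqpair (c, d)"
  have less: "(a + b) * (a + b) + a < (c + d) * (c + d) + c" if "a + b < c + d" for a b c d :: nat
  proof -
    have "(a + b) * (a + b) + a < Suc (a + b) * Suc (a + b)" by simp
    also have "\<dots> \<le> (c + d) * (c + d)" using that by (intro mult_le_mono) auto
    finally show ?thesis by simp
  qed
  have "a + b = c + d"
    using eq less[of a b c d] less[of c d a b] unfolding sqpair_def split
    by (metis linorder_neqE_nat less_irrefl)
  then show "a = c \<and> b = d" using eq by (simp add: sqpair_def)
qed

definition pairf :: "nat \<Rightarrow> nat" where
  "pairf z = (if z \<in> range sqpair then prod_encode (inv sqpair z) else 0)"

lemma pairf_sqpair: "pairf ((a + b) * (a + b) + a) = prod_encode (a, b)"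
proof -
  have "pairf (sqpair (a, b)) = prod_encode (a, b)"
    using inj_sqpair by (simp add: pairf_def)
  then show ?thesis by (simp add: sqpair_def)
qed

definition uncurried :: "(nat \<Rightarrow> nat \<Rightarrow> nat) \<Rightarrow> nat \<Rightarrow> nat" where
  "uncurried f z = f (fst (prod_decode z)) (snd (prod_decode z))"

lemma uncurried_encode [simp]: "uncurried f (prod_encode (a, b)) = f a b"
  by (simp add: uncurried_def)

lemma eq_uncurried_iff: "g = uncurried f \<longleftrightarrow> (\<forall>a b. g (prod_encode (a, b)) = f a b)"
proof
  assume *: "\<forall>a b. g (prod_encode (a, b)) = f a b"
  show "g = uncurried f"
  proof
    fix z
    obtain a b where "z = prod_encode (a, b)" by (metis prod_decode_inverse surj_pair)
    then show "g z = uncurried f z" using * by simp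
  qed
qed simp

definition Imp :: "fml \<Rightarrow> fml \<Rightarrow> fml" where "Imp p q = Or (Neg p) q"

lemma sat_Imp [simp]: "sat e F (Imp p q) \<longleftrightarrow> (sat e F p \<longrightarrow> sat e F q)"
  by (auto simp: Imp_def)

lemma arithmetical_Imp [simp]: "arithmetical (Imp p q) \<longleftrightarrow> arithmetical p \<and> arithmetical q"
  by (auto simp: Imp_def)

definition Iff :: "fml \<Rightarrow> fml \<Rightarrow> fml" where "Iff p q = And (Imp p q) (Imp q p)"

lemma sat_Iff [simp]: "sat e F (Iff p q) \<longleftrightarrow> (sat e F p \<longleftrightarrow> sat e F q)"
  by (auto simp: Iff_def)

lemma arithmetical_Iff [simp]: "arithmetical (Iff p q) \<longleftrightarrow> arithmetical p \<and> arithmetical q"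
  by (auto simp: Iff_def)

primrec tnum :: "nat \<Rightarrow> trm" where
  "tnum 0 = Zero"
| "tnum (Suc k) = Succ (tnum k)"

lemma trm_val_tnum [simp]: "trm_val e F (tnum k) = k"
  by (induction k) auto

definition prt :: "trm \<Rightarrow> trm \<Rightarrow> trm" where
  "prt s t = App 0 (Plus (Times (Plus s t) (Plus s t)) s)"

lemma trm_val_prt: "F 0 = pairf \<Longrightarrow>
    trm_val e F (prt s t) = prod_encode (trm_val e F s, trm_val e F t)"
  by (simp add: prt_def pairf_sqpair)

definition pairing_fml :: fml where
  "pairing_fml = And
    (AllN 0 (AllN 1 (pair_eq (NVar 0) (NVar 1) (prt (NVar 0) (NVar 1)))))
    (AllN 2 (Or (ExN 0 (ExN 1 (Equal (NVar 2)
        (Plus (Times (Plus (NVar 0) (NVar 1)) (Plus (NVar 0) (NVar 1))) (NVar 0)))))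
      (Equal (App 0 (NVar 2)) Zero)))"

lemma sat_pairing_fml: "sat e F pairing_fml \<longleftrightarrow> F 0 = pairf"
proof -
  have "sat e F pairing_fml \<longleftrightarrow> (\<forall>a b. F 0 (sqpair (a, b)) = prod_encode (a, b)) \<and>
      (\<forall>z. (\<exists>a b. z = sqpair (a, b)) \<or> F 0 z = 0)"
    by (simp add: pairing_fml_def sat_pair_eq prt_def sqpair_def)
  also have "\<dots> \<longleftrightarrow> F 0 = pairf"
  proof (intro iffI ext)
    fix z
    assume *: "(\<forall>a b. F 0 (sqpair (a, b)) = prod_encode (a, b)) \<and>
      (\<forall>z. (\<exists>a b. z = sqpair (a, b)) \<or> F 0 z = 0)"
    show "F 0 z = pairf z"
    proof (cases "z \<in> range sqpair")
      case True
      then obtain a b where "z = sqpair (a, b)" by auto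
      then show ?thesis using * inj_sqpair by (simp add: pairf_def)
    next
      case False
      then have "F 0 z = 0" using * by (metis rangeI)
      then show ?thesis using False by (simp add: pairf_def)
    qed
  next
    assume "F 0 = pairf"
    then show "(\<forall>a b. F 0 (sqpair (a, b)) = prod_encode (a, b)) \<and>
      (\<forall>z. (\<exists>a b. z = sqpair (a, b)) \<or> F 0 z = 0)"
      using inj_sqpair by (auto simp: pairf_def)
  qed
  finally show ?thesis .
qed

section \<open>Recursion clauses characterizing the universal function\<close>

locale univ_spec =
  fixes H :: "nat \<Rightarrow> nat \<Rightarrow> nat"
  assumes zero: "\<And>y x. H (prod_encode (0, y)) x = Suc 0"
    and succ: "\<And>y x. H (prod_encode (Suc 0, y)) x = Suc (Suc x)"
    and left: "\<And>y a b. H (prod_encode (2, y)) (prod_encode (a, b)) = Suc a"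
    and right: "\<And>y a b. H (prod_encode (3, y)) (prod_encode (a, b)) = Suc b"
    and pair: "\<And>a b x. (H (prod_encode (4, prod_encode (a, b))) x = 0 \<and> (H a x = 0 \<or> H b x = 0)) \<or>
      (\<exists>u v. H (prod_encode (4, prod_encode (a, b))) x = Suc (prod_encode (u, v)) \<and>
        H a x = Suc u \<and> H b x = Suc v)"
    and comp: "\<And>a b x. (H (prod_encode (5, prod_encode (a, b))) x = 0 \<and> H b x = 0) \<or>
      (\<exists>v. H (prod_encode (5, prod_encode (a, b))) x = H a v \<and> H b x = Suc v)"
    and prec_0: "\<And>a b x. H (prod_encode (6, prod_encode (a, b))) (prod_encode (x, 0)) = H a x"
    and prec_Suc: "\<And>a b x m. (H (prod_encode (6, prod_encode (a, b))) (prod_encode (x, Suc m)) = 0 \<and>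
        H (prod_encode (6, prod_encode (a, b))) (prod_encode (x, m)) = 0) \<or>
      (\<exists>v. H (prod_encode (6, prod_encode (a, b))) (prod_encode (x, Suc m)) =
          H b (prod_encode (x, prod_encode (m, v))) \<and>
        H (prod_encode (6, prod_encode (a, b))) (prod_encode (x, m)) = Suc v)"
    and search: "\<And>t y x. (H (prod_encode (t + 7, y)) x = 0 \<and> \<not> (\<exists>m. H y (prod_encode (x, m)) = Suc 0 \<and>
        (\<forall>i<m. Suc 0 < H y (prod_encode (x, i))))) \<or>
      (\<exists>m. H (prod_encode (t + 7, y)) x = Suc m \<and> H y (prod_encode (x, m)) = Suc 0 \<and>
        (\<forall>i<m. Suc 0 < H y (prod_encode (x, i))))"

lemma mu_search_eq_Some_iff:
  "mu_search f x = Some m \<longleftrightarrow> f (prod_encode (x, m)) = Some 0 \<and>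
     (\<forall>i<m. f (prod_encode (x, i)) \<noteq> None \<and> f (prod_encode (x, i)) \<noteq> Some 0)"
proof
  assume *: "mu_search f x = Some m"
  then obtain k where k: "f (prod_encode (x, k)) = Some 0" "\<forall>j<k. f (prod_encode (x, j)) \<noteq> None"
    by (auto simp: mu_search_def split: if_splits)
  have m: "m = (LEAST m. f (prod_encode (x, m)) = Some 0)"
    using * by (auto simp: mu_search_def split: if_splits)
  have "m \<le> k" using k m by (auto intro: Least_le)
  moreover have "f (prod_encode (x, m)) = Some 0" using k m by (metis (lifting) LeastI)
  ultimately show "f (prod_encode (x, m)) = Some 0 \<and>
     (\<forall>i<m. f (prod_encode (x, i)) \<noteq> None \<and> f (prod_encode (x, i)) \<noteq> Some 0)"
    using k m by (auto dest: not_less_Least)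
next
  assume *: "f (prod_encode (x, m)) = Some 0 \<and>
     (\<forall>i<m. f (prod_encode (x, i)) \<noteq> None \<and> f (prod_encode (x, i)) \<noteq> Some 0)"
  then have "(LEAST m. f (prod_encode (x, m)) = Some 0) = m"
    by (intro Least_equality) (auto simp: not_less[symmetric])
  then show "mu_search f x = Some m" using * by (auto simp: mu_search_def)
qed

lemma uval_eq_Suc_iff: "uval c x = Suc y \<longleftrightarrow> univ c x = Some y"
  by (auto simp: uval_def split: option.split)

lemma uval_eq_0_iff: "uval c x = 0 \<longleftrightarrow> univ c x = None"
  by (auto simp: uval_def split: option.split)

lemma univ_spec_uval: "univ_spec uval"
proof
  fix a b x y t m :: nat
  show "uval (prod_encode (0, y)) x = Suc 0"
    by (simp add: uval_eq_Suc_iff univ.simps[of "prod_encode (0, y)"])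
  show "uval (prod_encode (Suc 0, y)) x = Suc (Suc x)"
    by (simp add: uval_eq_Suc_iff univ.simps[of "prod_encode (Suc 0, y)"])
  show "uval (prod_encode (2, y)) (prod_encode (a, b)) = Suc a"
    by (simp add: uval_eq_Suc_iff univ.simps[of "prod_encode (2, y)"])
  show "uval (prod_encode (3, y)) (prod_encode (a, b)) = Suc b"
    by (simp add: uval_eq_Suc_iff univ.simps[of "prod_encode (3, y)"])
  show "(uval (prod_encode (4, prod_encode (a, b))) x = 0 \<and> (uval a x = 0 \<or> uval b x = 0)) \<or>
      (\<exists>u v. uval (prod_encode (4, prod_encode (a, b))) x = Suc (prod_encode (u, v)) \<and>
        uval a x = Suc u \<and> uval b x = Suc v)"
    by (auto simp: uval_eq_Suc_iff uval_eq_0_iff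
        univ.simps[of "prod_encode (4, prod_encode (a, b))"] split: option.split)
  show "(uval (prod_encode (5, prod_encode (a, b))) x = 0 \<and> uval b x = 0) \<or>
      (\<exists>v. uval (prod_encode (5, prod_encode (a, b))) x = uval a v \<and> uval b x = Suc v)"
    by (auto simp: uval_def univ.simps[of "prod_encode (5, prod_encode (a, b))"] map_comp_def split: option.split)
  have 6: "univ (prod_encode (6, prod_encode (a, b))) (prod_encode (x, k)) =
      prim_rec (univ a) (univ b) x k" for k
    by (simp add: univ.simps[of "prod_encode (6, prod_encode (a, b))"])
  show "uval (prod_encode (6, prod_encode (a, b))) (prod_encode (x, 0)) = uval a x"
    by (simp add: uval_def 6)
  show "(uval (prod_encode (6, prod_encode (a, b))) (prod_encode (x, Suc m)) = 0 \<and>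
        uval (prod_encode (6, prod_encode (a, b))) (prod_encode (x, m)) = 0) \<or>
      (\<exists>v. uval (prod_encode (6, prod_encode (a, b))) (prod_encode (x, Suc m)) =
          uval b (prod_encode (x, prod_encode (m, v))) \<and>
        uval (prod_encode (6, prod_encode (a, b))) (prod_encode (x, m)) = Suc v)"
    by (auto simp: uval_def 6 split: option.split)
  have 7: "univ (prod_encode (t + 7, y)) x = mu_search (univ y) x"
    by (simp add: univ.simps[of "prod_encode (t + 7, y)"])
  have gt: "Suc 0 < uval y z \<longleftrightarrow> univ y z \<noteq> None \<and> univ y z \<noteq> Some 0" for z
    by (auto simp: uval_def split: option.split)
  show "(uval (prod_encode (t + 7, y)) x = 0 \<and> \<not> (\<exists>m. uval y (prod_encode (x, m)) = Suc 0 \<and>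
        (\<forall>i<m. Suc 0 < uval y (prod_encode (x, i))))) \<or>
      (\<exists>m. uval (prod_encode (t + 7, y)) x = Suc m \<and> uval y (prod_encode (x, m)) = Suc 0 \<and>
        (\<forall>i<m. Suc 0 < uval y (prod_encode (x, i))))"
    unfolding uval_eq_Suc_iff uval_eq_0_iff gt 7 mu_search_eq_Some_iff[symmetric]
    by (metis option.exhaust)
qed

text \<open>Induction on the code: the clauses refer to smaller codes, except that primitive
  recursion also refers to its own code at a smaller counter and takes an inner induction. For
  search, the first zero is unique.\<close>

lemma univ_spec_unique:
  assumes H: "univ_spec H" and H': "univ_spec H'"
  shows "H = H'"
proof -
  have "H c = H' c" for c
  proof (induction c rule: less_induct)
    case (less c)
    obtain t y where c: "c = prod_encode (t, y)" by (metis prod_decode_inverse surj_pair)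
    obtain a b where y: "y = prod_encode (a, b)" by (metis prod_decode_inverse surj_pair)
    have "y < c" if "t > 0" using snd_prod_decode_less[of c] that by (simp add: c)
    moreover have "a \<le> y" "b \<le> y" using y by (auto intro: le_prod_encode_1 le_prod_encode_2)
    ultimately have IH: "H y = H' y" "H a = H' a" "H b = H' b" if "t > 0"
      using less that by (meson le_less_trans)+
    have "t = 0 \<or> t = 1 \<or> t = 2 \<or> t = 3 \<or> t = 4 \<or> t = 5 \<or> t = 6 \<or> t = (t - 7) + 7"
      by arith
    then consider "t = 0" | "t = 1" | "t = 2" | "t = 3" | "t = 4" | "t = 5" | "t = 6" | s where "t = s + 7"
      by blast
    then show ?case
    proof cases
      case 1
      then show ?thesis using univ_spec.zero[OF H] univ_spec.zero[OF H'] by (simp add: c fun_eq_iff)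
    next
      case 2
      then show ?thesis using univ_spec.succ[OF H] univ_spec.succ[OF H'] by (simp add: c fun_eq_iff)
    next
      case 3
      have "H c x = H' c x" for x
        using univ_spec.left[OF H] univ_spec.left[OF H'] unfolding c 3
        by (metis prod_decode_inverse surj_pair)
      then show ?thesis by auto
    next
      case 4
      have "H c x = H' c x" for x
        using univ_spec.right[OF H] univ_spec.right[OF H'] unfolding c 4
        by (metis prod_decode_inverse surj_pair)
      then show ?thesis by auto
    next
      case 5
      have "(H c x = 0 \<and> (H a x = 0 \<or> H b x = 0)) \<or>
          (\<exists>u v. H c x = Suc (prod_encode (u, v)) \<and> H a x = Suc u \<and> H b x = Suc v)"
        "(H' c x = 0 \<and> (H a x = 0 \<or> H b x = 0)) \<or>
          (\<exists>u v. H' c x = Suc (prod_encode (u, v)) \<and> H a x = Suc u \<and> H b x = Suc v)" for x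
        using univ_spec.pair[OF H, of a b x] univ_spec.pair[OF H', of a b x] IH 5 by (simp_all add: c y)
      then show ?thesis by (intro ext) (metis nat.distinct(1) nat.inject)
    next
      case 6
      have "(H c x = 0 \<and> H b x = 0) \<or> (\<exists>v. H c x = H a v \<and> H b x = Suc v)"
        "(H' c x = 0 \<and> H b x = 0) \<or> (\<exists>v. H' c x = H a v \<and> H b x = Suc v)" for x
        using univ_spec.comp[OF H, of a b x] univ_spec.comp[OF H', of a b x] IH 6 by (simp_all add: c y)
      then show ?thesis by (intro ext) (metis nat.distinct(1) nat.inject)
    next
      case 7
      have base: "H c (prod_encode (x, 0)) = H' c (prod_encode (x, 0))" for x
        using univ_spec.prec_0[OF H, of a b x] univ_spec.prec_0[OF H', of a b x] IH 7 by (simp add: c y)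
      have step: "(H c (prod_encode (x, Suc m)) = 0 \<and> H c (prod_encode (x, m)) = 0) \<or>
          (\<exists>v. H c (prod_encode (x, Suc m)) = H b (prod_encode (x, prod_encode (m, v))) \<and>
            H c (prod_encode (x, m)) = Suc v)"
        "(H' c (prod_encode (x, Suc m)) = 0 \<and> H' c (prod_encode (x, m)) = 0) \<or>
          (\<exists>v. H' c (prod_encode (x, Suc m)) = H b (prod_encode (x, prod_encode (m, v))) \<and>
            H' c (prod_encode (x, m)) = Suc v)" for x m
        using univ_spec.prec_Suc[OF H, of a b x m] univ_spec.prec_Suc[OF H', of a b x m] IH 7
        by (simp_all add: c y)
      have "H c (prod_encode (x, m)) = H' c (prod_encode (x, m))" for x m
      proof (induction m)
        case 0
        show ?case by (rule base)
      next
        case (Suc m)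
        then show ?case using step[of x m] by auto
      qed
      then show ?thesis by (intro ext) (metis prod_decode_inverse surj_pair)
    next
      case 8
      define good where "good x m \<longleftrightarrow> H y (prod_encode (x, m)) = Suc 0 \<and>
        (\<forall>i<m. Suc 0 < H y (prod_encode (x, i)))" for x m
      have good_unique: "m = m'" if "good x m" "good x m'" for x m m'
        using that unfolding good_def by (metis less_irrefl linorder_neqE_nat)
      have "(H c x = 0 \<and> \<not> (\<exists>m. good x m)) \<or> (\<exists>m. H c x = Suc m \<and> good x m)"
        "(H' c x = 0 \<and> \<not> (\<exists>m. good x m)) \<or> (\<exists>m. H' c x = Suc m \<and> good x m)" for x
        using univ_spec.search[OF H, of s y x] univ_spec.search[OF H', of s y x] IH 8
        by (simp_all add: c good_def)
      then show ?thesis using good_unique by (intro ext) metis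
    qed
  qed
  then show ?thesis by auto
qed

primrec Conj :: "fml list \<Rightarrow> fml" where
  "Conj [] = Equal Zero Zero"
| "Conj (p # ps) = And p (Conj ps)"

abbreviation Ut :: "trm \<Rightarrow> trm \<Rightarrow> trm" where
  "Ut s t \<equiv> App 1 (prt s t)"

definition univ_fml :: fml where
  "univ_fml = (let a = NVar 0; b = NVar 1; x = NVar 2; m = NVar 3; u = NVar 4; v = NVar 5;
      tag = (\<lambda>k. prt (tnum k));
      ab = prt a b;
      srch = prt (Plus a (tnum 7)) b;
      good = And (Equal (Ut b (prt x m)) (tnum 1))
        (AllN 6 (Imp (Less (NVar 6) m) (Less (tnum 1) (Ut b (prt x (NVar 6)))))) in
    Conj [
      AllN 1 (AllN 2 (Equal (Ut (tag 0 b) x) (tnum 1))),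
      AllN 1 (AllN 2 (Equal (Ut (tag 1 b) x) (Succ (Succ x)))),
      AllN 2 (AllN 0 (AllN 1 (Equal (Ut (tag 2 x) ab) (Succ a)))),
      AllN 2 (AllN 0 (AllN 1 (Equal (Ut (tag 3 x) ab) (Succ b)))),
      AllN 0 (AllN 1 (AllN 2 (Or
        (And (Equal (Ut (tag 4 ab) x) Zero) (Or (Equal (Ut a x) Zero) (Equal (Ut b x) Zero)))
        (ExN 4 (ExN 5 (And (Equal (Ut (tag 4 ab) x) (Succ (prt u v)))
          (And (Equal (Ut a x) (Succ u)) (Equal (Ut b x) (Succ v))))))))),
      AllN 0 (AllN 1 (AllN 2 (Or
        (And (Equal (Ut (tag 5 ab) x) Zero) (Equal (Ut b x) Zero))
        (ExN 5 (And (Equal (Ut (tag 5 ab) x) (Ut a v)) (Equal (Ut b x) (Succ v))))))),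
      AllN 0 (AllN 1 (AllN 2 (Equal (Ut (tag 6 ab) (prt x Zero)) (Ut a x)))),
      AllN 0 (AllN 1 (AllN 2 (AllN 3 (Or
        (And (Equal (Ut (tag 6 ab) (prt x (Succ m))) Zero) (Equal (Ut (tag 6 ab) (prt x m)) Zero))
        (ExN 5 (And (Equal (Ut (tag 6 ab) (prt x (Succ m))) (Ut b (prt x (prt m v))))
          (Equal (Ut (tag 6 ab) (prt x m)) (Succ v)))))))),
      AllN 0 (AllN 1 (AllN 2 (Or
        (And (Equal (Ut srch x) Zero) (Neg (ExN 3 good)))
        (ExN 3 (And (Equal (Ut srch x) (Succ m)) good)))))])"

lemma sat_univ_fml:
  assumes "F 0 = pairf"
  shows "sat e F univ_fml \<longleftrightarrow> F 1 = uncurried uval"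
proof -
  have "sat e F univ_fml \<longleftrightarrow> univ_spec (\<lambda>c x. F 1 (prod_encode (c, x)))"
    by (simp add: univ_fml_def Let_def trm_val_prt[of F, OF assms] univ_spec_def)
  also have "\<dots> \<longleftrightarrow> F 1 = uncurried uval"
  proof -
    have "univ_spec H \<longleftrightarrow> (\<forall>c x. H c x = uval c x)" for H
      unfolding fun_eq_iff[symmetric] using univ_spec_uval univ_spec_unique by blast
    then show ?thesis by (simp only: eq_uncurried_iff)
  qed
  finally show ?thesis .
qed

section \<open>Formulas for the functions built on the universal one\<close>

abbreviation Rt :: "trm \<Rightarrow> trm \<Rightarrow> trm" where
  "Rt s t \<equiv> App 2 (prt s t)"

definition rval_fml :: fml where
  "rval_fml = (let a = NVar 0; b = NVar 1; x = NVar 2; w = NVar 3;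
      reachf = (\<lambda>w. ExN 4 (And (Equal (Ut a (NVar 4)) (Succ (Succ (Plus x x))))
        (Equal (Ut b (NVar 4)) (Succ (Succ (Plus w w)))))) in
    AllN 0 (AllN 1 (AllN 2 (Or
      (And (Equal (Rt (prt a b) x) Zero) (AllN 3 (Neg (reachf w))))
      (ExN 3 (And (Equal (Rt (prt a b) x) (Succ w))
        (And (reachf w) (AllN 5 (Imp (Less (NVar 5) w) (Neg (reachf (NVar 5))))))))))))"

lemma sat_rval_fml:
  assumes "F 0 = pairf" "F 1 = uncurried uval"
  shows "sat e F rval_fml \<longleftrightarrow> F 2 = uncurried rval"
proof -
  have 1: "F (Suc 0) = uncurried uval" using assms(2) by simp
  have reach_alt: "reach (prod_encode (a, b)) x w \<longleftrightarrow>
      (\<exists>y. uval a y = Suc (Suc (x + x)) \<and> uval b y = Suc (Suc (w + w)))" for a b x w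
    by (simp add: reach_def mult_2)
  have "sat e F rval_fml \<longleftrightarrow> (\<forall>a b x. let j = prod_encode (a, b); r = F 2 (prod_encode (j, x)) in
      (r = 0 \<and> (\<forall>w. \<not> reach j x w)) \<or>
      (\<exists>w. r = Suc w \<and> reach j x w \<and> (\<forall>v<w. \<not> reach j x v)))"
    by (simp add: rval_fml_def Let_def trm_val_prt[of F, OF assms(1)] 1 reach_alt)
  also have "\<dots> \<longleftrightarrow> (\<forall>a b x. F 2 (prod_encode (prod_encode (a, b), x)) = rval (prod_encode (a, b)) x)"
    unfolding Let_def rval_eq_0_iff[symmetric] rval_eq_Suc_iff[symmetric]
    by (metis not0_implies_Suc)
  also have "\<dots> \<longleftrightarrow> F 2 = uncurried rval"
    unfolding eq_uncurried_iff by (metis prod_decode_inverse surj_pair)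
  finally show ?thesis .
qed

text \<open>Bound variables start at 20 here, at 10 in \<open>cellf\<close> and
  \<open>avoidsf\<close>, and stay below 10 in \<open>greedyf\<close>, which prevents capture in the
  nested formulas.\<close>

definition piecef :: "nat \<Rightarrow> nat \<Rightarrow> fml" where
  "piecef i l = ExN 20 (ExN 21 (And (Equal (prt (NVar 20) (NVar 21)) (NVar i))
    (Or (And (Equal (NVar 21) Zero) (Equal (Rt (NVar 20) (NVar l)) Zero))
      (ExN 22 (ExN 23 (And (Equal (NVar 21) (Succ (NVar 22)))
        (Equal (Rt (NVar 20) (NVar l)) (Succ (prt (NVar 22) (NVar 23))))))))))"

lemma sat_piecef:
  assumes "F 0 = pairf" "F 2 = uncurried rval" "i < 20" "l < 20"
  shows "sat e F (piecef i l) \<longleftrightarrow> piece (e i) (e l)"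
proof -
  obtain j k where jk: "e i = prod_encode (j, k)" by (metis prod_decode_inverse surj_pair)
  show ?thesis
    using assms(3,4) by (simp add: piecef_def trm_val_prt[of F, OF assms(1)] assms(2) jk piece_def)
qed

definition cellf :: "nat \<Rightarrow> nat \<Rightarrow> fml" where
  "cellf i l = AllN 10 (Imp (Less (NVar 10) (NVar i))
    (Iff (piecef 10 l) (Equal (App 3 (NVar 10)) Zero)))"

lemma sat_cellf:
  assumes "F 0 = pairf" "F 2 = uncurried rval" "i < 10" "l < 10"
  shows "sat e F (cellf i l) \<longleftrightarrow> (\<forall>a<e i. piece a (e l) \<longleftrightarrow> F 3 a = 0)"
  using assms(3,4) by (simp add: cellf_def sat_piecef[of F, OF assms(1,2)])

definition side_fml :: fml where
  "side_fml = (let inff = AllN 1 (ExN 2 (And (Less (NVar 1) (NVar 2)) (And (cellf 0 2) (piecef 0 2)))) in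
    AllN 0 (Or (And (Equal (App 3 (NVar 0)) Zero) inff)
      (And (Equal (App 3 (NVar 0)) (tnum 1)) (Neg inff))))"

text \<open>Infinity of a set of numbers is arithmetical, namely unboundedness, and a
  course-of-values recursion has only one solution.\<close>

lemma sat_side_fml:
  assumes "F 0 = pairf" "F 2 = uncurried rval"
  shows "sat e F side_fml \<longleftrightarrow> F 3 = side"
proof -
  define I where "I f i = {x. (\<forall>a\<in>{..<i}. piece a x \<longleftrightarrow> f a = 0) \<and> piece i x}" for f :: "nat \<Rightarrow> nat" and i
  have inf_I: "infinite (I f i) \<longleftrightarrow>
      (\<forall>m. \<exists>n>m. (\<forall>a<i. piece a n \<longleftrightarrow> f a = 0) \<and> piece i n)" for f i
    by (simp add: I_def infinite_nat_iff_unbounded Ball_def)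
  have "sat e F side_fml \<longleftrightarrow>
      (\<forall>i. F 3 i = 0 \<and> infinite (I (F 3) i) \<or> F 3 i = 1 \<and> \<not> infinite (I (F 3) i))"
    unfolding inf_I
    by (simp add: side_fml_def Let_def sat_cellf[of F, OF assms] sat_piecef[of F, OF assms])
  also have "\<dots> \<longleftrightarrow> (\<forall>i. F 3 i = (if infinite (I (F 3) i) then 0 else 1))"
    by (intro all_cong1) auto
  also have "\<dots> \<longleftrightarrow> F 3 = side"
  proof
    assume *: "\<forall>i. F 3 i = (if infinite (I (F 3) i) then 0 else 1)"
    have "F 3 i = side i" for i
    proof (induction i rule: less_induct)
      case (less i)
      then have I: "I (F 3) i = I side i" by (simp add: I_def)
      have "F 3 i = (if infinite (I side i) then 0 else 1)"
        unfolding I[symmetric] by (rule *[rule_format])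
      also have "\<dots> = side i" unfolding I_def by (rule side.simps[symmetric])
      finally show ?case .
    qed
    then show "F 3 = side" by auto
  next
    assume "F 3 = side"
    then show "\<forall>i. F 3 i = (if infinite (I (F 3) i) then 0 else 1)"
      unfolding I_def by (intro allI) (simp only:, rule side.simps)
  qed
  finally show ?thesis .
qed

lemma eq_Least_iff:
  fixes y :: nat
  assumes "\<exists>x. P x"
  shows "y = (LEAST x. P x) \<longleftrightarrow> P y \<and> (\<forall>x<y. \<not> P x)"
  using assms by (metis LeastI_ex not_less_Least linorder_neqE_nat)

text \<open>Each greedy choice depends only on earlier ones, so induction leaves a single solution.
  Spelling out leastness makes the condition expressible by a formula, for \<open>coh\<close> and
  \<open>dia\<close> alike.\<close>

lemma greedy_unique:
  fixes f s :: "nat \<Rightarrow> nat"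
  assumes ex: "\<And>i f. \<exists>x. P i x \<and> (\<forall>j\<in>{..<i}. f j \<noteq> x)"
    and s: "\<And>i. s i = (LEAST x. P i x \<and> (\<forall>j\<in>{..<i}. s j \<noteq> x))"
  shows "(\<forall>i. (P i (f i) \<and> (\<forall>j<i. f j \<noteq> f i)) \<and> (\<forall>x<f i. \<not> (P i x \<and> (\<forall>j<i. f j \<noteq> x)))) \<longleftrightarrow> f = s"
proof -
  have "(\<forall>i. (P i (f i) \<and> (\<forall>j<i. f j \<noteq> f i)) \<and> (\<forall>x<f i. \<not> (P i x \<and> (\<forall>j<i. f j \<noteq> x)))) \<longleftrightarrow>
      (\<forall>i. f i = (LEAST x. P i x \<and> (\<forall>j\<in>{..<i}. f j \<noteq> x)))"
    using eq_Least_iff[OF ex] by (simp add: Ball_def)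
  also have "\<dots> \<longleftrightarrow> f = s"
  proof
    assume *: "\<forall>i. f i = (LEAST x. P i x \<and> (\<forall>j\<in>{..<i}. f j \<noteq> x))"
    have "f i = s i" for i
    proof (induction i rule: less_induct)
      case (less i)
      then have "(\<lambda>x. P i x \<and> (\<forall>j\<in>{..<i}. f j \<noteq> x)) = (\<lambda>x. P i x \<and> (\<forall>j\<in>{..<i}. s j \<noteq> x))"
        by auto
      then show ?case using * s[of i] by metis
    qed
    then show "f = s" by auto
  next
    assume "f = s"
    then show "\<forall>i. f i = (LEAST x. P i x \<and> (\<forall>j\<in>{..<i}. f j \<noteq> x))"
      using s by blast
  qed
  finally show ?thesis .
qed

definition greedyf :: "nat \<Rightarrow> (nat \<Rightarrow> nat \<Rightarrow> fml) \<Rightarrow> fml" where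
  "greedyf k P = (let new = (\<lambda>l. And (P 0 l)
      (AllN 9 (Imp (Less (NVar 9) (NVar 0)) (Neg (Equal (App k (NVar 9)) (NVar l)))))) in
    AllN 0 (ExN 1 (And (Equal (App k (NVar 0)) (NVar 1))
      (And (new 1) (AllN 2 (Imp (Less (NVar 2) (NVar 1)) (Neg (new 2))))))))"

lemma sat_greedyf:
  assumes "\<And>e i l. i < 9 \<Longrightarrow> l < 9 \<Longrightarrow> sat e F (P i l) \<longleftrightarrow> Q (e i) (e l)"
    and "\<And>i f. \<exists>x. Q i x \<and> (\<forall>j\<in>{..<i}. f j \<noteq> x)"
    and "\<And>i. s i = (LEAST x. Q i x \<and> (\<forall>j\<in>{..<i}. s j \<noteq> x))"
  shows "sat e F (greedyf k P) \<longleftrightarrow> F k = s"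
  unfolding greedy_unique[OF assms(2,3), symmetric, of "F k"]
  by (simp add: greedyf_def Let_def assms(1))

lemma sat_coh:
  assumes "F 0 = pairf" "F 2 = uncurried rval" "F 3 = side"
  shows "sat e F (greedyf 4 cellf) \<longleftrightarrow> F 4 = coh"
proof (rule sat_greedyf)
  show "sat e F (cellf i l) \<longleftrightarrow> e l \<in> cell (e i)" if "i < 9" "l < 9" for e i l
    using that by (simp add: sat_cellf[of F, OF assms(1,2)] assms(3) cell_def)
qed (rule coh_exists coh.simps)+

definition avoidsf :: "nat \<Rightarrow> nat \<Rightarrow> fml" where
  "avoidsf i l = AllN 10 (Imp (Less (NVar 10) (Succ (NVar i)))
    (AllN 11 (Neg (Equal (Rt (NVar 10) (App 4 (NVar 11))) (Succ (NVar l))))))"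

lemma sat_dia:
  assumes "F 0 = pairf" "F 2 = uncurried rval" "F 4 = coh"
  shows "sat e F (greedyf 5 avoidsf) \<longleftrightarrow> F 5 = dia"
proof (rule sat_greedyf)
  show "sat e F (avoidsf i l) \<longleftrightarrow> avoids (e i) (e l)" if "i < 9" "l < 9" for e i l
    using that by (simp add: avoidsf_def trm_val_prt[of F, OF assms(1)] assms(2,3) avoids_def
        less_Suc_eq_le)
qed (rule dia_exists dia.simps)+

definition invf :: "nat \<Rightarrow> nat \<Rightarrow> fml" where
  "invf k l = AllN 0 (Or
    (ExN 1 (And (Equal (App l (NVar 1)) (NVar 0)) (Equal (App k (NVar 0)) (NVar 1))))
    (And (AllN 1 (Neg (Equal (App l (NVar 1)) (NVar 0)))) (Equal (App k (NVar 0)) Zero)))"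

lemma sat_invf:
  assumes "F l = s" "inj s"
  shows "sat e F (invf k l) \<longleftrightarrow> F k = left_inv0 s"
proof -
  have "sat e F (invf k l) \<longleftrightarrow> (\<forall>x. s (F k x) = x \<or> ((\<forall>i. s i \<noteq> x) \<and> F k x = 0))"
    using assms(1) by (auto simp: invf_def)
  also have "\<dots> \<longleftrightarrow> (\<forall>x. F k x = left_inv0 s x)"
  proof (intro all_cong1)
    fix x
    show "(s (F k x) = x \<or> ((\<forall>i. s i \<noteq> x) \<and> F k x = 0)) \<longleftrightarrow> F k x = left_inv0 s x"
    proof (cases "x \<in> range s")
      case True
      then obtain i where "x = s i" by blast
      then show ?thesis using assms(2) by (auto simp: left_inv0_def inj_eq)
    next
      case False
      then have "s i \<noteq> x" for i by blast
      then show ?thesis using False by (simp add: left_inv0_def)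
    qed
  qed
  finally show ?thesis by (simp add: fun_eq_iff)
qed

definition diagf :: "nat \<Rightarrow> nat \<Rightarrow> fml" where
  "diagf p q = (let u = Equal (Ut (NVar 0) (NVar 0)) (tnum 1) in
    AllN 0 (Or (And u (Equal (App 8 (NVar 0)) (tnum p))) (And (Neg u) (Equal (App 8 (NVar 0)) (tnum q)))))"

lemma sat_diagf:
  assumes "F 0 = pairf" "F 1 = uncurried uval"
  shows "sat e F (diagf p q) \<longleftrightarrow> F 8 = diag p q"
proof -
  have "F (Suc 0) = uncurried uval" using assms(2) by simp
  then show ?thesis
    by (auto simp: diagf_def Let_def trm_val_prt[of F, OF assms(1)] diag_def fun_eq_iff)
qed

definition joinf :: "nat \<Rightarrow> nat \<Rightarrow> nat \<Rightarrow> fml" where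
  "joinf k l m = AllN 0 (And (Equal (App k (Plus (NVar 0) (NVar 0))) (App l (NVar 0)))
    (Equal (App k (Succ (Plus (NVar 0) (NVar 0)))) (App m (NVar 0))))"

lemma sat_joinf:
  assumes "F l = f" "F m = g"
  shows "sat e F (joinf k l m) \<longleftrightarrow> F k = fjoin f g"
proof -
  have "sat e F (joinf k l m) \<longleftrightarrow> (\<forall>x. F k (2 * x) = f x \<and> F k (Suc (2 * x)) = g x)"
    using assms by (simp add: joinf_def mult_2)
  also have "\<dots> \<longleftrightarrow> F k = fjoin f g"
  proof
    assume *: "\<forall>x. F k (2 * x) = f x \<and> F k (Suc (2 * x)) = g x"
    show "F k = fjoin f g"
    proof
      fix z
      show "F k z = fjoin f g z"
        using *[rule_format, of "z div 2"] by (cases "even z") (auto simp: fjoin_def)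
    qed
  qed (auto simp: fjoin_def)
  finally show ?thesis .
qed

text \<open>Each entry is arithmetically determined by earlier ones, and its position is the
  function variable standing for it. Entries 6, 9, 10 and 11 turn \<open>\<nu>\<close> into
  \<open>\<alpha>1\<close>, \<open>\<beta>\<close>, \<open>\<alpha>0\<close> and the join of
  \<open>\<alpha>0\<close> and \<open>\<alpha>1\<close>.\<close>

definition witness :: "nat \<Rightarrow> nat \<Rightarrow> nat \<Rightarrow> nat \<Rightarrow> nat" where
  "witness p q i = [pairf, uncurried uval, uncurried rval, side, coh, dia,
    left_inv0 coh, left_inv0 dia, diag p q,
    fjoin (diag p q) (left_inv0 coh), fjoin (diag p q) (left_inv0 dia),
    fjoin (fjoin (diag p q) (left_inv0 dia)) (left_inv0 coh)] ! i"

lemma implicitly_definable_witness: "implicitly_definable 12 (witness p q)"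
proof -
  define P where "P = Conj [pairing_fml, univ_fml, rval_fml, side_fml, greedyf 4 cellf, greedyf 5 avoidsf,
    invf 6 4, invf 7 5, diagf p q, joinf 9 8 6, joinf 10 8 7, joinf 11 10 6]"
  have "arithmetical P"
    by (simp add: P_def pairing_fml_def univ_fml_def rval_fml_def side_fml_def greedyf_def cellf_def piecef_def
        avoidsf_def invf_def diagf_def joinf_def pair_eq_def Let_def)
  moreover have "sat e F P \<longleftrightarrow> (\<forall>i<12. F i = witness p q i)" for e F
  proof -
    have less_12: "i < 12 \<longleftrightarrow> i = 0 \<or> i = 1 \<or> i = 2 \<or> i = 3 \<or> i = 4 \<or> i = 5 \<or> i = 6 \<or> i = 7 \<or>
        i = 8 \<or> i = 9 \<or> i = 10 \<or> i = 11" for i :: nat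
      by presburger
    \<comment> \<open>\<open>conj_cong\<close> hands the equations for earlier components to the
      later conjuncts, whose characterizations assume them.\<close>
    have "sat e F P \<longleftrightarrow> F 0 = pairf \<and> F 1 = uncurried uval \<and> F 2 = uncurried rval \<and>
        F 3 = side \<and> F 4 = coh \<and> F 5 = dia \<and> F 6 = left_inv0 coh \<and> F 7 = left_inv0 dia \<and>
        F 8 = diag p q \<and> F 9 = fjoin (diag p q) (left_inv0 coh) \<and>
        F 10 = fjoin (diag p q) (left_inv0 dia) \<and>
        F 11 = fjoin (fjoin (diag p q) (left_inv0 dia)) (left_inv0 coh)"
      by (simp only: P_def Conj.simps sat.simps trm_val.simps sat_pairing_fml sat_univ_fml sat_rval_fml sat_side_fml
          sat_coh sat_dia sat_invf[OF _ inj_coh] sat_invf[OF _ inj_dia] sat_diagf sat_joinf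
          simp_thms cong: conj_cong)
    also have "\<dots> \<longleftrightarrow> (\<forall>i<12. F i = witness p q i)"
      unfolding less_12 unfolding imp_disjL all_conj_distrib by (simp add: witness_def)
    finally show ?thesis .
  qed
  ultimately show ?thesis unfolding implicitly_definable_def by blast
qed

lemma E1_computable_witness:
  assumes "n \<ge> 1" "E1_computable_numbering n S \<nu>" "i < 12" "surj (witness p q i)"
  shows "E1_computable_numbering n S (\<nu> \<circ> witness p q i)"
proof -
  have "range (\<nu> \<circ> witness p q i) = range \<nu>"
    using assms(4) by (simp only: image_comp[symmetric])
  then show ?thesis
    using E1_reindex[OF implicitly_definable_witness assms(3,1), of \<nu> p q] assms(2)
    by (simp add: E1_computable_numbering_def numbering_def)
qed

section \<open>Failure of weak distributivity\<close>

lemma num_le_join_left: "num_le \<nu> (num_join \<nu> \<mu>)"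
  unfolding num_le_def
  by (rule exI[of _ "\<lambda>x. 2 * x"]) (auto simp: computable_double num_join_def)

theorem theorem5p5:
  fixes n :: nat and S :: "nat set set"
  assumes "n \<ge> 1"
    and "infinite S"
    and "E1_computable_family n S"
  shows "\<not> weakly_distributive (rogers n S) rogers_le (rogers_join n S)"
proof
  assume wd: "weakly_distributive (rogers n S) rogers_le (rogers_join n S)"
  obtain \<nu> where \<nu>: "E1_computable_numbering n S \<nu>"
    using assms(3) by (auto simp: E1_computable_family_def)
  then have range_\<nu>: "range \<nu> = S" by (simp add: E1_computable_numbering_def numbering_def)
  have inf: "infinite (range \<nu>)" using assms(2) range_\<nu> by simp
  obtain p q where pq: "\<nu> p \<noteq> \<nu> q"
  proof (rule ccontr)
    assume "\<not> thesis"
    then have "range \<nu> \<subseteq> {\<nu> 0}" using that by blast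
    then show False using inf finite_subset by blast
  qed
  let ?h = "left_inv0 coh" and ?k = "left_inv0 dia" and ?d = "diag p q"
  define \<alpha>0 where "\<alpha>0 = \<nu> \<circ> fjoin ?d ?k"
  define \<alpha>1 where "\<alpha>1 = \<nu> \<circ> ?h"
  define \<beta> where "\<beta> = \<nu> \<circ> fjoin ?d ?h"
  have surj: "surj ?h" "surj ?k"
    using surj_left_inv0 inj_coh inj_dia by auto
  note comp = E1_computable_witness[OF assms(1) \<nu>, of _ p q]
  have \<alpha>1: "E1_computable_numbering n S \<alpha>1"
    using comp[of 6] surj by (simp add: witness_def \<alpha>1_def)
  have \<beta>: "E1_computable_numbering n S \<beta>"
    using comp[of 9] surj surj_fjoin by (simp add: witness_def \<beta>_def)
  have \<alpha>0: "E1_computable_numbering n S \<alpha>0"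
    using comp[of 10] surj surj_fjoin by (simp add: witness_def \<alpha>0_def)
  have join: "E1_computable_numbering n S (num_join \<alpha>0 \<alpha>1)"
    using comp[of 11] surj surj_fjoin by (simp add: witness_def \<alpha>0_def \<alpha>1_def num_join_fjoin)
  \<comment> \<open>Applied twice: to \<open>\<beta>\<close> itself, giving
    \<open>\<not> num_le \<beta> \<alpha>0\<close>, and to the first part of a splitting of
    \<open>\<beta>\<close>.\<close>
  have common: False if "num_le \<delta> \<beta>" "num_le \<delta> \<alpha>0" "range \<delta> = S" for \<delta>
  proof -
    obtain f where f: "computable f" "\<delta> = \<beta> \<circ> f" using \<open>num_le \<delta> \<beta>\<close> by (auto simp: num_le_def)
    obtain g where g: "computable g" "\<delta> = \<alpha>0 \<circ> g" using \<open>num_le \<delta> \<alpha>0\<close> by (auto simp: num_le_def)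
    have "finite (range \<delta>)"
      using no_common_lower_bound[OF inf f(1) g(1), of p q] f(2) g(2)
      unfolding \<alpha>0_def \<beta>_def by metis
    then show False using that(3) assms(2) by simp
  qed
  have "num_le \<beta> (num_join \<alpha>0 \<alpha>1)"
  proof -
    \<comment> \<open>An even \<open>x\<close> is also an index of \<open>\<alpha>0\<close>, which
      the join doubles; an odd \<open>x\<close> means the same in both joins. The decoded pair is
      just \<open>x\<close>, in the form that \<open>computable_case_nat\<close> produces.\<close>
    let ?t = "\<lambda>x. case x mod 2 of 0 \<Rightarrow> 2 * x | Suc k \<Rightarrow> fst (prod_decode (prod_encode (x, k)))"
    have "computable ?t"
      by (intro computable_case_nat computable_double computable_fst computable_mod_2)
    moreover have "\<beta> = num_join \<alpha>0 \<alpha>1 \<circ> ?t"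
    proof
      fix x
      show "\<beta> x = (num_join \<alpha>0 \<alpha>1 \<circ> ?t) x"
      proof (cases "even x")
        case True
        then have "x mod 2 = 0" by presburger
        then show ?thesis using True by (simp add: \<beta>_def \<alpha>0_def num_join_def fjoin_def)
      next
        case False
        then have "x mod 2 = Suc 0" by presburger
        then show ?thesis using False by (simp add: \<beta>_def \<alpha>1_def num_join_def fjoin_def)
      qed
    qed
    ultimately show ?thesis unfolding num_le_def by blast
  qed
  moreover have "\<not> num_le \<beta> \<alpha>0"
    using common[of \<beta>] num_le_refl \<beta> by (auto simp: E1_computable_numbering_def numbering_def)
  moreover have "\<not> num_le \<beta> \<alpha>1"
  proof
    assume "num_le \<beta> \<alpha>1"
    moreover have "num_le (\<nu> \<circ> ?d) \<beta>"
      using num_le_join_left[of "\<nu> \<circ> ?d" "\<nu> \<circ> ?h"] by (simp add: \<beta>_def num_join_fjoin)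
    ultimately have "num_le (\<nu> \<circ> ?d) \<alpha>1" by (blast intro: num_le_trans)
    then show False
      using diag_not_below_cohesive[OF inf pq] by (auto simp: num_le_def \<alpha>1_def)
  qed
  moreover define cl where "cl \<mu> = num_equiv n S `` {\<mu>}" for \<mu>
  have cl_rogers: "cl \<mu> \<in> rogers n S" if "E1_computable_numbering n S \<mu>" for \<mu>
    using that by (auto simp: rogers_def cl_def intro: quotientI)
  have self: "\<mu> \<in> cl \<mu>" if "E1_computable_numbering n S \<mu>" for \<mu>
    using that num_le_refl by (auto simp: cl_def num_equiv_def)
  have "rogers_le (cl \<beta>) (rogers_join n S (cl \<alpha>0) (cl \<alpha>1))"
  proof -
    have "num_join \<alpha>0 \<alpha>1 \<in> rogers_join n S (cl \<alpha>0) (cl \<alpha>1)"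
      using self[OF \<alpha>0] self[OF \<alpha>1] self[OF join] by (auto simp: rogers_join_def cl_def)
    then show ?thesis
      using \<open>num_le \<beta> (num_join \<alpha>0 \<alpha>1)\<close> self[OF \<beta>] by (auto simp: rogers_le_def)
  qed
  ultimately obtain b0 b1 where b: "b0 \<in> rogers n S" "b1 \<in> rogers n S"
      "cl \<beta> = rogers_join n S b0 b1" "rogers_le b0 (cl \<alpha>0)"
    using wd cl_rogers[OF \<alpha>0] cl_rogers[OF \<alpha>1] cl_rogers[OF \<beta>]
      rogers_le_classes[OF \<beta> \<alpha>0] rogers_le_classes[OF \<beta> \<alpha>1]
    unfolding weakly_distributive_def cl_def by meson
  obtain \<delta> where \<delta>: "E1_computable_numbering n S \<delta>" "b0 = cl \<delta>"
    using b(1) by (auto simp: rogers_def cl_def elim: quotientE)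
  have "num_le \<delta> \<alpha>0"
    using b(4) rogers_le_classes[OF \<delta>(1) \<alpha>0] \<delta>(2) by (simp add: cl_def)
  moreover have "num_le \<delta> \<beta>"
  proof -
    \<comment> \<open>The join of classes consists of numberings equivalent to joins of
      representatives; as \<open>\<beta>\<close> is one of these, \<open>\<delta>'\<close> and with
      it \<open>\<delta>\<close> lies below \<open>\<beta>\<close>.\<close>
    obtain \<delta>' \<mu> where "\<delta>' \<in> b0" "(num_join \<delta>' \<mu>, \<beta>) \<in> num_equiv n S"
      using self[OF \<beta>] b(3) by (auto simp: rogers_join_def)
    then have "num_le \<delta> \<delta>'" "num_le (num_join \<delta>' \<mu>) \<beta>"
      using \<delta>(2) by (auto simp: cl_def num_equiv_def)
    then show ?thesis using num_le_join_left num_le_trans by blast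
  qed
  moreover have "range \<delta> = S"
    using \<delta>(1) by (simp add: E1_computable_numbering_def numbering_def)
  ultimately show False using common by blast
qed

end
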